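(* For each prime $p\equiv1\bmod3$, the image of $BP_*$ under the genus $\varphi^S$ is contained in the subring of $S_3$-invariant $p$-local automorphic forms: $$\varphi^S(BP_* )\subset M_*^{\mathbb{Z}_{(p)}}(\Gamma[\sqrt{-3}])^{S_3}\cong\mathbb{Z}_{(p)}[\sigma_1,\sigma_2,\sigma_3],$$ where $\sigma_i=\sigma_i(\xi_0,\xi_1,\xi_2)$ is the $i$-th elementary symmetric function in $\xi_0,\xi_1,\xi_2$.
   Context: Let $\zeta_3=e^{2\pi i/3}$, $H_3=\begin{pmatrix}0&0&1\\0&1&0\\1&0&0\end{pmatrix}$, $\Gamma=U(H_3;\mathbb{Z}[\zeta_3])\cong U(2,1;\mathbb{Z}[\zeta_3])$, and let $\Gamma[\sqrt{-3}]$ be the kernel of reduction modulo $\sqrt{-3}$. An automorphic form of topological degree $6k$ for $\Gamma[\sqrt{-3}]$ is a holomorphic function $\phi$ on $\mathbb{L}_2=\{(z_0,z_1)\in\mathbb{C}^2:z_0+\bar z_0+|z_1|^2<0\}$ with $\phi(\gamma.z)=(\gamma_{31}z_0+\gamma_{32}z_1+\gamma_{33})^{3k}\phi(z)$ for all $\gamma\in\Gamma[\sqrt{-3}]$ (action via lines $[z_0:z_1:1]$). By Shiga, the graded ring of these forms is the polynomial ring $\mathbb{C}[\xi_0,\xi_1,\xi_2]$ on three forms of topological degree $6$, the parameters of the Picard curves $y^3=x(x-\xi_0)(x-\xi_1)(x-\xi_2)$. The $p$-local forms are $M_*^{\mathbb{Z}_{(p)}}(\Gamma[\sqrt{-3}])=\mathbb{Z}_{(p)}[\xi_0,\xi_1,\xi_2]$,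 and $S_3$ acts by permuting $\xi_0,\xi_1,\xi_2$. A rational genus $\varphi$ is a ring homomorphism out of $MU_*\otimes\mathbb{Q}$, determined by its logarithm $\log_\varphi(u)=\sum_{n\ge0}\varphi([\mathbb{C}P^n])\frac{u^{n+1}}{n+1}$. The genus $\varphi^S\colon MU_*\otimes\mathbb{Q}\to\mathbb{Q}[\xi_0,\xi_1,\xi_2]$ is defined by $$\log_{\varphi^S}'(u)=\big((1-\xi_0u^3)(1-\xi_1u^3)(1-\xi_2u^3)\big)^{-1/3}.$$ For a prime $p$, $BP_*=\mathbb{Z}_{(p)}[v_1,v_2,\dots]\subset MU_*\otimes\mathbb{Z}_{(p)}$ is the coefficient ring of Brown–Peterson homology, where the Hazewinkel generators $v_k$ are determined by $p\ell_k=\sum_{i=0}^{k-1}\ell_i v_{k-i}^{p^i}$ with $\ell_i=[\mathbb{C}P^{p^i-1}]/p^i$. *)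

theory Defs
  imports
    "HOL-Analysis.Analysis"
    "HOL-Library.Function_Algebras"
    "HOL-Library.Poly_Mapping"
    "HOL-Computational_Algebra.Formal_Power_Series"
    "HOL-Number_Theory.Cong"
begin

section \<open>Multivariate polynomials\<close>

text \<open>Monomials are finitely supported exponent functions.\<close>

type_synonym ('x, 'a) mpoly = "('x \<Rightarrow>\<^sub>0 nat) \<Rightarrow>\<^sub>0 'a"

definition mvar :: "'x \<Rightarrow> ('x, 'a::comm_ring_1) mpoly" where
  "mvar i = Poly_Mapping.single (Poly_Mapping.single i 1) 1"

definition mconst :: "'a::comm_ring_1 \<Rightarrow> ('x, 'a) mpoly" where
  "mconst a = Poly_Mapping.single 0 a"

definition mpolys_over :: "'a::comm_ring_1 set \<Rightarrow> ('x, 'a) mpoly set" where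
  "mpolys_over R = {F. \<forall>m. Poly_Mapping.lookup F m \<in> R}"

text \<open>Evaluation at the family \<open>x\<close>, where \<open>c\<close> maps the coefficients to the target ring.\<close>

definition eval_mpoly ::
    "('a::comm_ring_1 \<Rightarrow> 'b::comm_ring_1) \<Rightarrow> ('x \<Rightarrow> 'b) \<Rightarrow> ('x, 'a) mpoly \<Rightarrow> 'b" where
  "eval_mpoly c x F =
     (\<Sum>m\<in>Poly_Mapping.keys F. c (Poly_Mapping.lookup F m) *
       (\<Prod>i\<in>Poly_Mapping.keys m. x i ^ Poly_Mapping.lookup m i))"

definition ring_hom_on :: "'a::comm_ring_1 set \<Rightarrow> ('a \<Rightarrow> 'b::comm_ring_1) \<Rightarrow> bool" where
  "ring_hom_on A f \<longleftrightarrow> f 1 = 1 \<and>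
     (\<forall>a\<in>A. \<forall>b\<in>A. f (a + b) = f a + f b \<and> f (a * b) = f a * f b)"

definition ring_iso_on ::
    "'a::comm_ring_1 set \<Rightarrow> 'b::comm_ring_1 set \<Rightarrow> ('a \<Rightarrow> 'b) \<Rightarrow> bool" where
  "ring_iso_on A B f \<longleftrightarrow> ring_hom_on A f \<and> bij_betw f A B"

definition localized_ints :: "nat \<Rightarrow> 'a::field_char_0 set" where
  "localized_ints p = {of_int a / of_int b | a b. \<not> int p dvd b}"

definition elem_sym :: "nat \<Rightarrow> ('x::finite \<Rightarrow> 'a::comm_ring_1) \<Rightarrow> 'a" where
  "elem_sym n x = (\<Sum>S | card S = n. \<Prod>i\<in>S. x i)"


section \<open>Picard modular forms for the congruence subgroup of level \<open>\<surd>-3\<close>\<close>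

definition zeta3 :: complex where
  "zeta3 = cis (2 * pi / 3)"

definition eisenstein_ints :: "complex set" where
  "eisenstein_ints = {of_int a + of_int b * zeta3 | a b. True}"

definition H3 :: "complex^3^3" where
  "H3 = vector [vector [0, 0, 1], vector [0, 1, 0], vector [1, 0, 0]]"

definition hermitian_adjoint :: "complex^3^3 \<Rightarrow> complex^3^3" where
  "hermitian_adjoint A = (\<chi> i j. cnj (A $ j $ i))"

definition picard_group :: "(complex^3^3) set" where
  "picard_group = {\<gamma>. (\<forall>i j. \<gamma> $ i $ j \<in> eisenstein_ints) \<and>
     hermitian_adjoint \<gamma> ** H3 ** \<gamma> = H3}"

definition picard_congruence_group :: "(complex^3^3) set" where
  "picard_congruence_group = {\<gamma> \<in> picard_group. \<forall>i j.
     \<exists>a\<in>eisenstein_ints. \<gamma> $ i $ j - mat 1 $ i $ j = \<i> * of_real (sqrt 3) * a}"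

definition siegel_domain :: "(complex \<times> complex) set" where
  "siegel_domain = {(z0, z1). Re (z0 + cnj z0) + (cmod z1)\<^sup>2 < 0}"

text \<open>Forms are functions on a type of points of the domain, so that they are determined by
  their values there and form a ring with unit under the pointwise operations.\<close>

typedef siegel_point = siegel_domain
proof
  show "(-1, 0) \<in> siegel_domain" by (simp add: siegel_domain_def)
qed

definition cocycle :: "complex^3^3 \<Rightarrow> complex \<times> complex \<Rightarrow> complex" where
  "cocycle \<gamma> z = \<gamma> $ 3 $ 1 * fst z + \<gamma> $ 3 $ 2 * snd z + \<gamma> $ 3 $ 3"

definition proj_action :: "complex^3^3 \<Rightarrow> complex \<times> complex \<Rightarrow> complex \<times> complex" where
  "proj_action \<gamma> z =
     ((\<gamma> $ 1 $ 1 * fst z + \<gamma> $ 1 $ 2 * snd z + \<gamma> $ 1 $ 3) / cocycle \<gamma> z,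
      (\<gamma> $ 2 $ 1 * fst z + \<gamma> $ 2 $ 2 * snd z + \<gamma> $ 2 $ 3) / cocycle \<gamma> z)"

text \<open>Holomorphy in two variables: the Frechet derivative exists and is complex linear at every
  point of the (open) domain.\<close>

definition holomorphic_on_siegel :: "(siegel_point \<Rightarrow> complex) \<Rightarrow> bool" where
  "holomorphic_on_siegel f \<longleftrightarrow> (\<forall>z\<in>siegel_domain. \<exists>a b.
     ((\<lambda>w. f (Abs_siegel_point w)) has_derivative (\<lambda>h. a * fst h + b * snd h)) (at z))"

text \<open>Forms of topological degree \<open>6 * k\<close>.\<close>

definition automorphic_forms :: "nat \<Rightarrow> (siegel_point \<Rightarrow> complex) set" where
  "automorphic_forms k = {f. holomorphic_on_siegel f \<and>
     (\<forall>\<gamma>\<in>picard_congruence_group. \<forall>z\<in>siegel_domain.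
        f (Abs_siegel_point (proj_action \<gamma> z)) = cocycle \<gamma> z ^ (3 * k) * f (Abs_siegel_point z))}"

text \<open>The graded ring, with the grading recorded by a formal variable: the component of
  topological degree \<open>6 * k\<close> is the coefficient of index \<open>k\<close>.\<close>

type_synonym graded_form = "(siegel_point \<Rightarrow> complex) poly"

definition automorphic_ring :: "graded_form set" where
  "automorphic_ring = {F. \<forall>k. coeff F k \<in> automorphic_forms k}"

definition form_const :: "complex \<Rightarrow> graded_form" where
  "form_const a = [:\<lambda>_. a:]"

text \<open>Shiga's theorem: the parameters \<open>\<xi>\<^sub>0, \<xi>\<^sub>1, \<xi>\<^sub>2\<close> of the Picard curves
  \<open>y\<^sup>3 = x (x - \<xi>\<^sub>0) (x - \<xi>\<^sub>1) (x - \<xi>\<^sub>2)\<close>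
  are forms of topological degree 6 that generate the graded ring as a polynomial ring over the
  complex numbers. Only this property of the triple is used, so we work with any such triple.\<close>

definition free_form_generators :: "(3 \<Rightarrow> graded_form) \<Rightarrow> bool" where
  "free_form_generators \<xi> \<longleftrightarrow>
     (\<forall>i. \<exists>f\<in>automorphic_forms 1. \<xi> i = monom f 1) \<and>
     bij_betw (eval_mpoly form_const \<xi>) UNIV automorphic_ring"

text \<open>The subring \<open>R[\<xi>\<^sub>0, \<xi>\<^sub>1, \<xi>\<^sub>2]\<close>.\<close>

definition forms_over :: "complex set \<Rightarrow> (3 \<Rightarrow> graded_form) \<Rightarrow> graded_form set" where
  "forms_over R \<xi> = eval_mpoly form_const \<xi> ` mpolys_over R"

definition local_forms :: "nat \<Rightarrow> (3 \<Rightarrow> graded_form) \<Rightarrow> graded_form set" where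
  "local_forms p \<xi> = forms_over (localized_ints p) \<xi>"

text \<open>Substituting \<open>\<xi> (\<tau> i)\<close> for \<open>\<xi> i\<close> in the polynomial expression of a form.\<close>

definition permute_form ::
    "(3 \<Rightarrow> graded_form) \<Rightarrow> (3 \<Rightarrow> 3) \<Rightarrow> graded_form \<Rightarrow> graded_form" where
  "permute_form \<xi> \<tau> f =
     eval_mpoly form_const (\<xi> \<circ> \<tau>) (inv_into UNIV (eval_mpoly form_const \<xi>) f)"

definition S3_invariants :: "(3 \<Rightarrow> graded_form) \<Rightarrow> graded_form set \<Rightarrow> graded_form set" where
  "S3_invariants \<xi> A = {f \<in> A. \<forall>\<tau>. bij \<tau> \<longrightarrow> permute_form \<xi> \<tau> f = f}"

text \<open>In the index type \<open>3\<close> of the variables, the numeral \<open>3\<close> equals \<open>0\<close>, so the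
  three elementary symmetric functions are indexed by \<open>1\<close>, \<open>2\<close> and \<open>3 = 0\<close>.\<close>

definition sigma :: "(3 \<Rightarrow> graded_form) \<Rightarrow> 3 \<Rightarrow> graded_form" where
  "sigma \<xi> i = elem_sym (if i = 1 then 1 else if i = 2 then 2 else 3) \<xi>"


section \<open>Rational complex bordism and the Hazewinkel generators\<close>

text \<open>\<open>MU\<^sub>* \<otimes> \<rat>\<close> is the rational polynomial ring on the classes of the complex projective
  spaces of positive dimension; the variable of index \<open>n\<close> is the class of dimension
  \<open>n + 1\<close>.\<close>

type_synonym MUQ = "(nat, rat) mpoly"

definition CP :: "nat \<Rightarrow> MUQ" where
  "CP n = (case n of 0 \<Rightarrow> 1 | Suc m \<Rightarrow> mvar m)"

definition bp_log :: "nat \<Rightarrow> nat \<Rightarrow> MUQ" where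
  "bp_log p i = mconst (1 / of_nat (p ^ i)) * CP (p ^ i - 1)"

text \<open>Only the values at positive arguments are generators; see \<open>hazewinkel_recursion\<close>.\<close>

fun hazewinkel :: "nat \<Rightarrow> nat \<Rightarrow> MUQ" where
  "hazewinkel p k =
     of_nat p * bp_log p k - (\<Sum>i = 1..<k. bp_log p i * hazewinkel p (k - i) ^ (p ^ i))"

declare hazewinkel.simps [simp del]

lemma hazewinkel_recursion:
  assumes "k > 0"
  shows "of_nat p * bp_log p k = (\<Sum>i<k. bp_log p i * hazewinkel p (k - i) ^ (p ^ i))"
proof -
  have "bp_log p 0 = 1"
    by (simp add: bp_log_def CP_def mconst_def)
  moreover have "{..<k} = insert 0 {1..<k}"
    using assms by auto
  ultimately show ?thesis
    by (simp add: hazewinkel.simps [of p k])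
qed

definition BP :: "nat \<Rightarrow> MUQ set" where
  "BP p = eval_mpoly mconst (\<lambda>k. hazewinkel p (Suc k)) ` mpolys_over (localized_ints p)"


section \<open>Genera\<close>

definition rational_genus :: "(MUQ \<Rightarrow> graded_form) \<Rightarrow> bool" where
  "rational_genus \<phi> \<longleftrightarrow> ring_hom_on UNIV \<phi>"

definition genus_log :: "(MUQ \<Rightarrow> graded_form) \<Rightarrow> graded_form fps" where
  "genus_log \<phi> = Abs_fps (\<lambda>n. if n = 0 then 0 else form_const (1 / of_nat n) * \<phi> (CP (n - 1)))"

text \<open>The binomial series of \<open>G\<close> with exponent \<open>a\<close>, for \<open>G\<close> with constant
  coefficient 1. (The library's \<^const>\<open>fps_binomial\<close> needs a field of coefficients.)\<close>

definition fps_rat_power :: "rat \<Rightarrow> graded_form fps \<Rightarrow> graded_form fps" where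
  "fps_rat_power a G = Abs_fps (\<lambda>n. form_const (of_rat (a gchoose n))) oo (G - 1)"

definition picard_genus :: "(3 \<Rightarrow> graded_form) \<Rightarrow> (MUQ \<Rightarrow> graded_form) \<Rightarrow> bool" where
  "picard_genus \<xi> \<phi> \<longleftrightarrow> rational_genus \<phi> \<and> range \<phi> \<subseteq> forms_over \<rat> \<xi> \<and>
     fps_deriv (genus_log \<phi>) = fps_rat_power (-1/3)
       ((1 - fps_const (\<xi> 0) * fps_X ^ 3) * (1 - fps_const (\<xi> 1) * fps_X ^ 3) *
        (1 - fps_const (\<xi> 2) * fps_X ^ 3))"

end

theory Submission
  imports Defs
begin

text \<open>Put \<open>P = (1 - \<xi>\<^sub>0 u\<^sup>3) (1 - \<xi>\<^sub>1 u\<^sup>3) (1 - \<xi>\<^sub>2 u\<^sup>3)\<close>, let \<open>A\<close> be its power with exponent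
  \<open>-1/3\<close>, the derivative of the logarithm, and let \<open>\<psi>\<close> be the Frobenius lift that raises every
  \<open>\<xi>\<^sub>i\<close> and \<open>u\<close> to the \<open>p\<close>-th power. As \<open>p\<close> is 1 modulo 3, \<open>A = g A\<^sup>p\<close> for the polynomial \<open>g\<close>
  that is the power of \<open>P\<close> with exponent \<open>(p - 1) / 3\<close>. Iterating this gives polynomials \<open>R\<^sub>j\<close>,
  divisible by the \<open>(j - 1)\<close>-st power of \<open>p\<close>, such that \<open>A\<close> is the \<open>p\<close>-adic sum of the
  \<open>R\<^sub>j \<psi>\<^sup>j(A)\<close>. The degree of \<open>R\<^sub>j\<close> is so small that the coefficient of index \<open>p\<^sup>s - 1\<close> in
  \<open>R\<^sub>j \<psi>\<^sup>j(A)\<close> is a single product. Hence the coefficients of the \<open>p\<close>-typical logarithm satisfy a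
  functional equation of Hazewinkel's type, and the images of the generators are \<open>p\<close>-integral.

  Every image is symmetric because \<open>P\<close> is. That the symmetric polynomials over a subring are
  freely generated by the elementary ones follows by comparing lexicographically leading
  monomials.\<close>

section \<open>Subrings, homomorphisms and evaluation of polynomials\<close>

locale subring_of =
  fixes S :: "'a::comm_ring_1 set"
  assumes one_closed [simp]: "1 \<in> S"
    and diff_closed [simp]: "a \<in> S \<Longrightarrow> b \<in> S \<Longrightarrow> a - b \<in> S"
    and mult_closed [simp]: "a \<in> S \<Longrightarrow> b \<in> S \<Longrightarrow> a * b \<in> S"
begin

lemma zero_closed [simp]: "0 \<in> S"
  using diff_closed [OF one_closed one_closed] by simp

lemma uminus_closed [simp]: "a \<in> S \<Longrightarrow> - a \<in> S"
  using diff_closed [OF zero_closed] by simp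

lemma add_closed [simp]: "a \<in> S \<Longrightarrow> b \<in> S \<Longrightarrow> a + b \<in> S"
  using diff_closed [OF _ uminus_closed, of a b] by simp

lemma power_closed [simp]: "a \<in> S \<Longrightarrow> a ^ n \<in> S"
  by (induction n) simp_all

lemma sum_closed: "(\<And>i. i \<in> I \<Longrightarrow> f i \<in> S) \<Longrightarrow> sum f I \<in> S"
  by (induction I rule: infinite_finite_induct) simp_all

lemma prod_closed: "(\<And>i. i \<in> I \<Longrightarrow> f i \<in> S) \<Longrightarrow> prod f I \<in> S"
  by (induction I rule: infinite_finite_induct) simp_all

lemma of_nat_closed [simp]: "of_nat n \<in> S"
  by (induction n) simp_all

end

locale unital_hom =
  fixes f :: "'a::comm_ring_1 \<Rightarrow> 'b::comm_ring_1"
  assumes hom: "ring_hom_on UNIV f"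
begin

lemma one [simp]: "f 1 = 1"
  and add [simp]: "f (a + b) = f a + f b"
  and mult [simp]: "f (a * b) = f a * f b"
  using hom by (simp_all add: ring_hom_on_def)

lemma zero [simp]: "f 0 = 0"
  using add [of 0 0] by (simp del: add)

lemma uminus [simp]: "f (- a) = - f a"
  by (metis add add.right_inverse add_eq_0_iff zero)

lemma diff [simp]: "f (a - b) = f a - f b"
  using add [of a "- b"] by (simp del: add)

lemma power [simp]: "f (a ^ n) = f a ^ n"
  by (induction n) simp_all

lemma sum: "f (sum g A) = (\<Sum>i\<in>A. f (g i))"
  by (induction A rule: infinite_finite_induct) simp_all

lemma prod: "f (prod g A) = (\<Prod>i\<in>A. f (g i))"
  by (induction A rule: infinite_finite_induct) simp_all

lemma of_nat [simp]: "f (of_nat n) = of_nat n"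
  by (induction n) simp_all

lemma of_int [simp]: "f (of_int k) = of_int k"
  by (cases k) (simp_all del: of_nat_Suc)

end

lemma unital_homI:
  assumes "f 1 = 1" "\<And>a b. f (a + b) = f a + f b" "\<And>a b. f (a * b) = f a * f b"
  shows "unital_hom f"
  using assms by (simp add: unital_hom_def ring_hom_on_def)

lemma unital_hom_comp: "unital_hom f \<Longrightarrow> unital_hom g \<Longrightarrow> unital_hom (f \<circ> g)"
  by (simp add: unital_hom_def ring_hom_on_def)

lemma unital_hom_funpow: "unital_hom (f :: 'a \<Rightarrow> 'a::comm_ring_1) \<Longrightarrow> unital_hom (f ^^ n)"
  by (induction n) (simp_all add: unital_hom_def ring_hom_on_def)

section \<open>Evaluation of monomials and polynomials\<close>

definition monom_eval :: "('x \<Rightarrow> 'b::comm_ring_1) \<Rightarrow> ('x \<Rightarrow>\<^sub>0 nat) \<Rightarrow> 'b" where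
  "monom_eval x m = (\<Prod>i\<in>Poly_Mapping.keys m. x i ^ Poly_Mapping.lookup m i)"

lemma monom_eval_superset:
  assumes "finite A" "Poly_Mapping.keys m \<subseteq> A"
  shows "monom_eval x m = (\<Prod>i\<in>A. x i ^ Poly_Mapping.lookup m i)"
  unfolding monom_eval_def using assms
  by (intro prod.mono_neutral_left) (auto simp: in_keys_iff)

lemma monom_eval_0 [simp]: "monom_eval x 0 = 1"
  by (simp add: monom_eval_def)

lemma monom_eval_single [simp]: "monom_eval x (Poly_Mapping.single i k) = x i ^ k"
  by (simp add: monom_eval_def)

lemma monom_eval_add: "monom_eval x (m + n) = monom_eval x m * monom_eval x n"
proof -
  let ?A = "Poly_Mapping.keys m \<union> Poly_Mapping.keys n"
  have "monom_eval x (m + n) = (\<Prod>i\<in>?A. x i ^ Poly_Mapping.lookup (m + n) i)"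
    by (intro monom_eval_superset) (simp_all add: Poly_Mapping.keys_add)
  also have "\<dots> = monom_eval x m * monom_eval x n"
    by (simp add: monom_eval_superset [of ?A] lookup_add power_add prod.distrib)
  finally show ?thesis .
qed

lemma mpoly_eq_sum_single:
  "(\<Sum>m\<in>Poly_Mapping.keys F. Poly_Mapping.single m (Poly_Mapping.lookup F m)) = F"
  by (rule poly_mapping_eqI)
    (simp add: lookup_sum lookup_single when_def in_keys_iff)

text \<open>Reduces products to monomials: multiplicativity of evaluation, closure of
  \<open>mpolys_over\<close> under products and the leading term of a product all rest on
  it.\<close>

lemma mpoly_mult_eq_sum_single:
  "F * G = (\<Sum>m\<in>Poly_Mapping.keys F. \<Sum>n\<in>Poly_Mapping.keys G.
     Poly_Mapping.single (m + n) (Poly_Mapping.lookup F m * Poly_Mapping.lookup G n))"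
proof -
  have "F * G = (\<Sum>m\<in>Poly_Mapping.keys F. Poly_Mapping.single m (Poly_Mapping.lookup F m)) *
      (\<Sum>n\<in>Poly_Mapping.keys G. Poly_Mapping.single n (Poly_Mapping.lookup G n))"
    by (simp only: mpoly_eq_sum_single)
  then show ?thesis
    by (simp add: sum_product mult_single)
qed

lemma eval_mpoly_superset:
  assumes "finite A" "Poly_Mapping.keys F \<subseteq> A" "c 0 = 0"
  shows "eval_mpoly c x F = (\<Sum>m\<in>A. c (Poly_Mapping.lookup F m) * monom_eval x m)"
  unfolding eval_mpoly_def monom_eval_def [symmetric] using assms
  by (intro sum.mono_neutral_left) (auto simp: in_keys_iff)

lemma eval_mpoly_single:
  assumes "c 0 = 0"
  shows "eval_mpoly c x (Poly_Mapping.single m a) = c a * monom_eval x m"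
  using eval_mpoly_superset [where A = "{m}" and F = "Poly_Mapping.single m a" and c = c and x = x] assms by simp

lemma eval_mpoly_add:
  assumes "c 0 = 0" "\<And>a b. c (a + b) = c a + c b"
  shows "eval_mpoly c x (F + G) = eval_mpoly c x F + eval_mpoly c x G"
proof -
  let ?A = "Poly_Mapping.keys F \<union> Poly_Mapping.keys G"
  have "eval_mpoly c x (F + G) = (\<Sum>m\<in>?A. c (Poly_Mapping.lookup (F + G) m) * monom_eval x m)"
    using assms by (intro eval_mpoly_superset) (simp_all add: Poly_Mapping.keys_add)
  then show ?thesis
    using assms eval_mpoly_superset [where A = ?A and F = F and c = c and x = x]
       eval_mpoly_superset [where A = ?A and F = G and c = c and x = x]
    by (simp add: lookup_add sum.distrib algebra_simps)
qed

lemma eval_mpoly_0 [simp]: "eval_mpoly c x 0 = 0"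
  by (simp add: eval_mpoly_def)

lemma eval_mpoly_sum:
  assumes "c 0 = 0" "\<And>a b. c (a + b) = c a + c b"
  shows "eval_mpoly c x (sum F I) = (\<Sum>i\<in>I. eval_mpoly c x (F i))"
  by (induction I rule: infinite_finite_induct) (simp_all add: eval_mpoly_add [OF assms])

lemma unital_hom_eval_mpoly:
  assumes "unital_hom c"
  shows "unital_hom (eval_mpoly c x)"
proof -
  interpret c: unital_hom c by fact
  note sum = eval_mpoly_sum [of c, OF c.zero c.add]
    and single = eval_mpoly_single [of c, OF c.zero]
  show ?thesis
  proof (rule unital_homI)
    show "eval_mpoly c x 1 = 1"
      using single [of x 0 1] by simp
    show "eval_mpoly c x (F + G) = eval_mpoly c x F + eval_mpoly c x G" for F G
      by (simp add: eval_mpoly_add)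
    show "eval_mpoly c x (F * G) = eval_mpoly c x F * eval_mpoly c x G" for F G
      unfolding mpoly_mult_eq_sum_single [of F G]
      unfolding sum single monom_eval_add eval_mpoly_def [of _ _ F] eval_mpoly_def [of _ _ G]
         monom_eval_def [symmetric]
      by (simp add: sum_product ac_simps)
  qed
qed

lemma unital_hom_mconst: "unital_hom mconst"
  by (rule unital_homI) (simp_all add: mconst_def single_add mult_single)

lemma eval_mpoly_mconst [simp]: "c 0 = 0 \<Longrightarrow> eval_mpoly c x (mconst a) = c a"
  by (simp add: mconst_def eval_mpoly_single)

lemma eval_mpoly_mvar [simp]: "unital_hom c \<Longrightarrow> eval_mpoly c x (mvar i) = x i"
  by (simp add: mvar_def eval_mpoly_single unital_hom.zero unital_hom.one)

text \<open>As \<open>h\<close> commutes with finite sums and products it passes inside the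
  evaluation. Composites of homomorphisms are thereby compared through constants and variables
  alone.\<close>

lemma hom_eval_mpoly:
  assumes "unital_hom h"
  shows "h (eval_mpoly c x F) = eval_mpoly (h \<circ> c) (h \<circ> x) F"
  using assms by (simp add: eval_mpoly_def unital_hom.sum unital_hom.prod unital_hom.mult unital_hom.power)

lemma mvar_power: "mvar i ^ n = Poly_Mapping.single (Poly_Mapping.single i n) 1"
  by (induction n) (simp_all add: mvar_def mult_single flip: single_add)

lemma prod_single_one:
  "(\<Prod>i\<in>A. Poly_Mapping.single (f i) 1) = Poly_Mapping.single (sum f A) (1 :: 'a::comm_ring_1)"
  by (induction A rule: infinite_finite_induct) (simp_all add: mult_single)

lemma monom_eval_mvar: "monom_eval mvar m = Poly_Mapping.single m 1"
  by (simp add: monom_eval_def mvar_power prod_single_one mpoly_eq_sum_single)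

text \<open>Exhibits a polynomial as built from constants and variables, so that congruences and
  equalities of homomorphisms can be checked on these.\<close>

lemma eval_mpoly_mvar_id: "eval_mpoly mconst mvar F = F"
  using mpoly_eq_sum_single [of F]
  by (simp add: eval_mpoly_def monom_eval_def [symmetric] monom_eval_mvar mconst_def mult_single)

lemma (in subring_of) eval_mpoly_closed:
  assumes "\<And>m. c (Poly_Mapping.lookup F m) \<in> S" "\<And>i. x i \<in> S"
  shows "eval_mpoly c x F \<in> S"
  unfolding eval_mpoly_def using assms by (intro sum_closed mult_closed prod_closed power_closed) auto

section \<open>Polynomials over a subring and the \<open>p\<close>-local integers\<close>

lemma subring_of_mpolys_over:
  assumes "subring_of A"
  shows "subring_of (mpolys_over A)"
proof -
  interpret A: subring_of A by fact
  show ?thesis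
  proof
    show "1 \<in> mpolys_over A"
      by (simp add: mpolys_over_def lookup_one when_def)
    show "F - G \<in> mpolys_over A" if "F \<in> mpolys_over A" "G \<in> mpolys_over A" for F G
      using that by (simp add: mpolys_over_def lookup_minus)
    show "F * G \<in> mpolys_over A" if "F \<in> mpolys_over A" "G \<in> mpolys_over A" for F G
      using that unfolding mpoly_mult_eq_sum_single [of F G]
      by (auto simp: mpolys_over_def lookup_sum lookup_single when_def intro!: A.sum_closed)
  qed
qed

lemma mconst_in_mpolys_over: "0 \<in> A \<Longrightarrow> a \<in> A \<Longrightarrow> mconst a \<in> mpolys_over A"
  by (simp add: mpolys_over_def mconst_def lookup_single when_def)

lemma mvar_in_mpolys_over: "0 \<in> A \<Longrightarrow> 1 \<in> A \<Longrightarrow> mvar i \<in> mpolys_over A"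
  by (simp add: mpolys_over_def mvar_def lookup_single when_def)

lemma subring_of_localized_ints:
  assumes "prime p"
  shows "subring_of (localized_ints p :: 'a::field_char_0 set)"
proof
  have p: "prime (int p)" using assms by simp
  show "1 \<in> (localized_ints p :: 'a set)"
    using p unfolding localized_ints_def by (intro CollectI exI [of _ 1]) auto
  fix x y :: 'a assume "x \<in> localized_ints p" "y \<in> localized_ints p"
  then obtain a b c d where xy: "x = of_int a / of_int b" "\<not> int p dvd b"
     "y = of_int c / of_int d" "\<not> int p dvd d"
    by (auto simp: localized_ints_def)
  have nz: "b \<noteq> 0" "d \<noteq> 0" using xy by auto
  have "\<not> int p dvd b * d" using xy p by (simp add: prime_dvd_mult_iff)
  moreover have "x - y = of_int (a * d - c * b) / of_int (b * d)" "x * y = of_int (a * c) / of_int (b * d)"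
    using nz by (simp_all add: xy field_simps)
  ultimately show "x - y \<in> localized_ints p" "x * y \<in> localized_ints p"
    unfolding localized_ints_def by blast+
qed

lemma inverse_of_nat_in_localized_ints:
  assumes "\<not> p dvd n"
  shows "1 / of_nat n \<in> localized_ints p"
  unfolding localized_ints_def using assms
  by (intro CollectI exI [of _ 1] exI [of _ "int n"]) auto

section \<open>Frobenius lifts\<close>

text \<open>Serves to regroup the double sum in \<open>hazewinkel_integral\<close> by the power of
  \<psi>.\<close>

lemma sum_triangle_swap:
  "(\<Sum>i = 1..<k. \<Sum>j = 1..i. f i j) = (\<Sum>j = 1..<k. \<Sum>i = j..<k. f i (j::nat) :: 'a::comm_monoid_add)"
proof (induction k)
  case (Suc k)
  show ?case
  proof (cases "k = 0")
    case False
    then have "(\<Sum>j = 1..<Suc k. \<Sum>i = j..<Suc k. f i j) = (\<Sum>j = 1..<Suc k. (\<Sum>i = j..<k. f i j) + f k j)"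
      by (intro sum.cong) simp_all
    also have "\<dots> = (\<Sum>j = 1..<k. \<Sum>i = j..<k. f i j) + (\<Sum>j = 1..k. f k j)"
      using False by (simp add: sum.distrib atLeastLessThanSuc_atLeastAtMost)
        (simp flip: atLeastLessThanSuc_atLeastAtMost)
    finally show ?thesis
      using Suc False by simp
  qed simp
qed simp

section \<open>The filtration of a subring by powers of \<open>p\<close>\<close>

locale subring_endo = subring_of S + hom: unital_hom \<psi>
  for S :: "'a::comm_ring_1 set" and \<psi> :: "'a \<Rightarrow> 'a" +
  fixes p :: nat
  assumes prime_p: "prime p" and endo_closed [simp]: "x \<in> S \<Longrightarrow> \<psi> x \<in> S"
begin

text \<open>The ideal generated by \<open>p ^ n\<close> in \<open>S\<close> itself. In the
  polynomial rings used below \<open>p\<close> is invertible, so divisibility there would carry no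
  information.\<close>

definition pS :: "nat \<Rightarrow> 'a set" where
  "pS n = (\<lambda>y. of_nat p ^ n * y) ` S"

lemma pS_subset: "x \<in> pS n \<Longrightarrow> x \<in> S"
  by (auto simp: pS_def)

lemma pS_0 [simp]: "pS 0 = S"
  by (simp add: pS_def)

lemma pS_I: "y \<in> S \<Longrightarrow> of_nat p ^ n * y \<in> pS n"
  by (simp add: pS_def)

lemma pS_1I: "y \<in> S \<Longrightarrow> of_nat p * y \<in> pS 1"
  using pS_I [of y 1] by simp

lemma pS_E: "x \<in> pS n \<Longrightarrow> (\<And>y. y \<in> S \<Longrightarrow> x = of_nat p ^ n * y \<Longrightarrow> thesis) \<Longrightarrow> thesis"
  by (auto simp: pS_def)

lemma pS_mult:
  assumes "x \<in> pS m" "y \<in> pS n"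
  shows "x * y \<in> pS (m + n)"
proof -
  obtain a b where "a \<in> S" "x = of_nat p ^ m * a" "b \<in> S" "y = of_nat p ^ n * b"
    using assms by (auto elim!: pS_E)
  then show ?thesis
    using pS_I [of "a * b" "m + n"] by (simp add: power_add ac_simps)
qed

lemma pS_mult_left: "x \<in> S \<Longrightarrow> y \<in> pS n \<Longrightarrow> x * y \<in> pS n"
  using pS_mult [of x 0 y n] by simp

lemma pS_mult_right: "x \<in> pS n \<Longrightarrow> y \<in> S \<Longrightarrow> x * y \<in> pS n"
  using pS_mult [of x n y 0] by simp

lemma pS_antimono:
  assumes "m \<le> n" "x \<in> pS n"
  shows "x \<in> pS m"
proof -
  obtain a where "a \<in> S" "x = of_nat p ^ n * a"
    using assms by (auto elim!: pS_E)
  then show ?thesis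
    using pS_I [of "of_nat p ^ (n - m) * a" m] assms(1)
    by (simp flip: power_add mult.assoc)
qed

lemma pS_diff: "x \<in> pS n \<Longrightarrow> y \<in> pS n \<Longrightarrow> x - y \<in> pS n"
  by (elim pS_E) (simp add: pS_I flip: right_diff_distrib)

lemma pS_add: "x \<in> pS n \<Longrightarrow> y \<in> pS n \<Longrightarrow> x + y \<in> pS n"
  by (elim pS_E) (simp add: pS_I flip: distrib_left)

lemma pS_zero: "0 \<in> pS n"
  using pS_I [OF zero_closed] by simp

lemma pS_uminus: "x \<in> pS n \<Longrightarrow> - x \<in> pS n"
  using pS_diff [OF pS_zero] by simp

lemma pS_sum: "(\<And>i. i \<in> I \<Longrightarrow> f i \<in> pS n) \<Longrightarrow> sum f I \<in> pS n"
  by (induction I rule: infinite_finite_induct) (simp_all add: pS_zero pS_add)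

lemma pS_trans: "x - y \<in> pS n \<Longrightarrow> y - z \<in> pS n \<Longrightarrow> x - z \<in> pS n"
  using pS_add [of "x - y" n "y - z"] by simp

lemma pS_mult_cong:
  "x - x' \<in> pS n \<Longrightarrow> y - y' \<in> pS n \<Longrightarrow> x \<in> S \<Longrightarrow> y' \<in> S \<Longrightarrow> x * y - x' * y' \<in> pS n"
  using pS_add [OF pS_mult_left [of x "y - y'" n] pS_mult_right [of "x - x'" n y']]
  by (simp add: algebra_simps)

lemma pS_power_cong:
  assumes "x - y \<in> pS n" "x \<in> S" "y \<in> S"
  shows "x ^ k - y ^ k \<in> pS n"
proof (induction k)
  case (Suc k)
  then show ?case
    using pS_mult_cong [OF assms(1) Suc] assms by simp
qed (simp add: pS_zero)

text \<open>The quotient of \<open>x ^ p - y ^ p\<close> by \<open>x - y\<close> is a sum of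
  \<open>p\<close> terms, each congruent to \<open>y ^ (p - 1)\<close> modulo \<open>p\<close>. So
  it contributes one more factor \<open>p\<close>.\<close>

lemma pS_power_p:
  assumes "x - y \<in> pS (Suc n)" "x \<in> S" "y \<in> S"
  shows "x ^ p - y ^ p \<in> pS (Suc (Suc n))"
proof -
  have 1: "x - y \<in> pS 1" using assms(1) by (rule pS_antimono [rotated]) simp
  have "(\<Sum>i<p. y ^ (p - Suc i) * x ^ i) = (\<Sum>i<p. y ^ (p - Suc i) * (x ^ i - y ^ i)) + (\<Sum>i<p. y ^ (p - 1))"
    unfolding sum.distrib [symmetric]
    by (intro sum.cong refl) (simp add: algebra_simps flip: power_add)
  also have "\<dots> = (\<Sum>i<p. y ^ (p - Suc i) * (x ^ i - y ^ i)) + of_nat p * y ^ (p - 1)"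
    by simp
  also have "\<dots> \<in> pS 1"
    by (intro pS_add pS_sum pS_mult_left pS_1I pS_power_cong) (use assms 1 in auto)
  finally have "(x - y) * (\<Sum>i<p. y ^ (p - Suc i) * x ^ i) \<in> pS (Suc n + 1)"
    using assms(1) by (rule pS_mult [rotated])
  then show ?thesis
    by (simp add: power_diff_sumr2)
qed

lemma pS_power_p_power:
  assumes "x - y \<in> pS 1" "x \<in> S" "y \<in> S"
  shows "x ^ (p ^ n) - y ^ (p ^ n) \<in> pS (Suc n)"
proof (induction n)
  case (Suc n)
  then have "(x ^ (p ^ n)) ^ p - (y ^ (p ^ n)) ^ p \<in> pS (Suc (Suc n))"
    using assms by (intro pS_power_p) auto
  then show ?case
    by (simp flip: power_mult add: mult.commute)
qed (use assms in simp)

text \<open>The binomial coefficients strictly between the two ends are divisible by the prime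
  \<open>p\<close>.\<close>

lemma add_power_p: 
  assumes "x \<in> S" "y \<in> S"
  shows "(x + y) ^ p - (x ^ p + y ^ p) \<in> pS 1"
proof -
  have p: "{..p} = insert 0 (insert p {1..<p})" 
    using prime_gt_0_nat [OF prime_p] by auto
  have "(x + y) ^ p - (x ^ p + y ^ p) = (\<Sum>k\<in>{1..<p}. of_nat (p choose k) * x ^ k * y ^ (p - k))"
    unfolding binomial_ring p using prime_gt_0_nat [OF prime_p] by simp
  also have "\<dots> \<in> pS 1"
  proof (intro pS_sum)
    fix k assume "k \<in> {1..<p}"
    then have "p dvd (p choose k)"
      using prime_p by (intro dvd_choose_prime) auto
    then obtain c where "p choose k = p * c" by auto
    then show "of_nat (p choose k) * x ^ k * y ^ (p - k) \<in> pS 1"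
      using assms pS_1I [of "of_nat c * x ^ k * y ^ (p - k)"] by (simp add: mult.assoc)
  qed
  finally show ?thesis .
qed

text \<open>The elements at which \<psi> lifts the Frobenius map. Their closure properties below
  allow the congruence to be checked on generators only.\<close>

definition frobenius_elems :: "'a set" where
  "frobenius_elems = {x \<in> S. \<psi> x - x ^ p \<in> pS 1}"

lemma frobenius_elems_add:
  assumes "x \<in> frobenius_elems" "y \<in> frobenius_elems"
  shows "x + y \<in> frobenius_elems"
proof -
  have xy: "x \<in> S" "y \<in> S" "\<psi> x - x ^ p \<in> pS 1" "\<psi> y - y ^ p \<in> pS 1"
    using assms by (auto simp: frobenius_elems_def)
  have "(\<psi> x - x ^ p) + (\<psi> y - y ^ p) - ((x + y) ^ p - (x ^ p + y ^ p)) \<in> pS 1"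
    by (rule pS_diff [OF pS_add [OF xy(3,4)] add_power_p [OF xy(1,2)]])
  then show ?thesis
    using assms by (simp add: frobenius_elems_def algebra_simps)
qed

lemma frobenius_elems_mult:
  assumes "x \<in> frobenius_elems" "y \<in> frobenius_elems"
  shows "x * y \<in> frobenius_elems"
  using assms pS_mult_cong [of "\<psi> x" "x ^ p" 1 "\<psi> y" "y ^ p"]
  by (simp add: frobenius_elems_def power_mult_distrib)

text \<open>Provides the denominators of the \<open>p\<close>-local integers: multiplying the
  congruence for \<open>x\<close> by \<open>y ^ p * \<psi> y\<close> turns it into the one for
  \<open>y\<close>, up to sign.\<close>

lemma frobenius_elems_inverse:
  assumes "x \<in> frobenius_elems" "x * y = 1" "y \<in> S"
  shows "y \<in> frobenius_elems"
proof -
  have psi: "\<psi> x * \<psi> y = 1"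
    using assms(2) hom.mult [of x y] by simp
  have pow: "x ^ p * y ^ p = 1"
    using assms(2) by (simp flip: power_mult_distrib)
  have "\<psi> y - y ^ p = (x ^ p * y ^ p) * \<psi> y - (\<psi> x * \<psi> y) * y ^ p"
    by (simp add: psi pow)
  also have "\<dots> = - (y ^ p * \<psi> y * (\<psi> x - x ^ p))"
    by (simp add: algebra_simps)
  also have "\<dots> \<in> pS 1"
    using assms by (intro pS_uminus pS_mult_left) (auto simp: frobenius_elems_def)
  finally show ?thesis
    using assms by (simp add: frobenius_elems_def)
qed

lemma frobenius_elems_of_nat: "of_nat n \<in> frobenius_elems"
proof (induction n)
  case 0
  then show ?case using prime_gt_0_nat [OF prime_p] by (simp add: frobenius_elems_def pS_zero power_0_left)
next
  case (Suc n)
  have "1 \<in> frobenius_elems" by (simp add: frobenius_elems_def pS_zero)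
  with Suc show ?case by (simp add: frobenius_elems_add del: of_nat_Suc add: of_nat_Suc)
qed

lemma frobenius_elems_power: "x \<in> frobenius_elems \<Longrightarrow> x ^ n \<in> frobenius_elems"
proof (induction n)
  case 0
  then show ?case using frobenius_elems_of_nat [of 1] by simp
qed (simp add: frobenius_elems_mult)

lemma frobenius_elems_sum: "(\<And>i. i \<in> I \<Longrightarrow> f i \<in> frobenius_elems) \<Longrightarrow> sum f I \<in> frobenius_elems"
  using frobenius_elems_of_nat [of 0]
  by (induction I rule: infinite_finite_induct) (simp_all add: frobenius_elems_add)

lemma frobenius_elems_prod: "(\<And>i. i \<in> I \<Longrightarrow> f i \<in> frobenius_elems) \<Longrightarrow> prod f I \<in> frobenius_elems"
  using frobenius_elems_of_nat [of 1]
  by (induction I rule: infinite_finite_induct) (simp_all add: frobenius_elems_mult)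

text \<open>Applying \<open>add_power_p\<close> to \<open>x\<close> and \<open>- x\<close> avoids
  the sign of \<open>(- x) ^ p\<close>, so that \<open>p = 2\<close> needs no separate case.\<close>

lemma frobenius_elems_uminus:
  assumes "x \<in> frobenius_elems" shows "- x \<in> frobenius_elems"
proof -
  have x: "x \<in> S" "- x \<in> S" "\<psi> x - x ^ p \<in> pS 1"
    using assms by (auto simp: frobenius_elems_def)
  have "((x + - x) ^ p - (x ^ p + (- x) ^ p)) - (\<psi> x - x ^ p) \<in> pS 1"
    by (rule pS_diff [OF add_power_p [OF x(1,2)] x(3)])
  moreover have "((x + - x) ^ p - (x ^ p + (- x) ^ p)) - (\<psi> x - x ^ p) = \<psi> (- x) - (- x) ^ p"
    using prime_gt_0_nat [OF prime_p] by (simp add: power_0_left)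
  ultimately have "\<psi> (- x) - (- x) ^ p \<in> pS 1"
    by (simp only:)
  with x(2) show ?thesis
    by (simp only: frobenius_elems_def mem_Collect_eq simp_thms)
qed

end

section \<open>Frobenius lifts and congruences between powers\<close>

locale frobenius_lift = subring_endo +
  assumes frobenius: "x \<in> S \<Longrightarrow> \<psi> x - x ^ p \<in> pS 1"
begin

lemma endo_pow_closed: "x \<in> S \<Longrightarrow> (\<psi> ^^ j) x \<in> S"
  by (induction j) simp_all

sublocale hom_pow: unital_hom "\<psi> ^^ j" for j
  by (rule unital_hom_funpow) unfold_locales

lemma frobenius_pow: "x \<in> S \<Longrightarrow> (\<psi> ^^ j) x - x ^ (p ^ j) \<in> pS 1"
proof (induction j)
  case (Suc j)
  have "\<psi> ((\<psi> ^^ j) x) - ((\<psi> ^^ j) x) ^ p \<in> pS 1"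
    using Suc by (intro frobenius endo_pow_closed)
  moreover have "((\<psi> ^^ j) x) ^ p - (x ^ (p ^ j)) ^ p \<in> pS 1"
    using Suc by (intro pS_power_cong endo_pow_closed) auto
  ultimately have "\<psi> ((\<psi> ^^ j) x) - (x ^ (p ^ j)) ^ p \<in> pS 1"
    by (rule pS_trans)
  then show ?case
    by (simp flip: power_mult add: mult.commute)
qed (simp add: pS_zero)

text \<open>The congruence between \<open>(\<psi> ^^ j) x\<close> and \<open>x ^ (p ^ j)\<close>
  holds modulo \<open>p\<close>; each of the \<open>n\<close> further \<open>p\<close>-th powers
  improves the modulus by one factor \<open>p\<close>.\<close>

lemma frobenius_pow_power:
  assumes "x \<in> S"
  shows "(\<psi> ^^ j) (x ^ (p ^ n)) - x ^ (p ^ (n + j)) \<in> pS (Suc n)"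
  using pS_power_p_power [OF frobenius_pow [OF assms, of j], of n] assms
  by (simp add: endo_pow_closed power_add mult.commute [of "p ^ n"] flip: power_mult)

text \<open>The exponents form a geometric sum. For \<open>g\<close> the power of \<open>P\<close>
  with exponent \<open>(p - 1) / 3\<close>, this is the power of \<open>P\<close> with exponent
  \<open>(p ^ s - 1) / 3\<close>.\<close>

definition geom_power :: "'a \<Rightarrow> nat \<Rightarrow> 'a" where
  "geom_power g s = (\<Prod>i<s. g ^ (p ^ i))"

lemma geom_power_closed: "g \<in> S \<Longrightarrow> geom_power g s \<in> S"
  unfolding geom_power_def by (intro prod_closed) auto

text \<open>The analogue of Vlasenko's decomposition of the powers with exponent \<open>p\<^sup>s - 1\<close>.\<close>

fun ghost_rest :: "'a \<Rightarrow> nat \<Rightarrow> 'a" where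
  "ghost_rest g s = geom_power g s - (\<Sum>j = 1..<s. ghost_rest g j * (\<psi> ^^ j) (geom_power g (s - j)))"

declare ghost_rest.simps [simp del]

text \<open>The recursion of \<open>ghost_rest\<close> with all its terms on one side; the term
  \<open>j = s\<close> is \<open>ghost_rest g s\<close> because \<open>geom_power g 0\<close> is
  1.\<close>

lemma geom_power_decomp:
  assumes "s > 0"
  shows "(\<Sum>j = 1..s. ghost_rest g j * (\<psi> ^^ j) (geom_power g (s - j))) = geom_power g s"
proof -
  have "{1..s} = insert s {1..<s}" using assms by auto
  then show ?thesis
    by (simp add: ghost_rest.simps [of g s] geom_power_def [of g 0])
qed

text \<open>By induction, \<open>ghost_rest g j\<close> supplies \<open>p ^ (j - 1)\<close>.
  Comparing the decompositions at \<open>s\<close> and \<open>s - 1\<close> leaves a difference of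
  powers that supplies \<open>p ^ (s - j)\<close>.\<close>

lemma ghost_rest_in_pS:
  assumes "g \<in> S" "s > 0"
  shows "ghost_rest g s \<in> pS (s - 1)"
  using \<open>s > 0\<close>
proof (induction s rule: less_induct)
  case (less s)
  note clo = geom_power_closed [OF assms(1)] endo_pow_closed
  show ?case
  proof (cases "s = 1")
    case True
    then show ?thesis
      by (simp add: ghost_rest.simps [of g "Suc 0"] clo)
  next
    case False
    then obtain t where t: "s = Suc t" "t > 0" using less.prems by (cases s) auto
    define h where "h = g ^ (p ^ t)"
    have eq: "geom_power g s = geom_power g t * h"
      by (simp add: geom_power_def t h_def)
    have "ghost_rest g s = geom_power g s - (\<Sum>j = 1..t. ghost_rest g j * (\<psi> ^^ j) (geom_power g (s - j)))"
      by (subst ghost_rest.simps) (simp add: t atLeastLessThanSuc_atLeastAtMost)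
    \<comment> \<open>The decomposition at \<open>t\<close>, multiplied by the last factor
      \<open>h\<close>, replaces \<open>geom_power g s\<close>, so the two sums can be subtracted
      term by term.\<close>
    also have "\<dots> = - (\<Sum>j = 1..t. ghost_rest g j * ((\<psi> ^^ j) (geom_power g (s - j)) - (\<psi> ^^ j) (geom_power g (t - j)) * h))"
      unfolding eq geom_power_decomp [OF t(2), of g, symmetric]
      by (simp add: sum_subtractf sum_distrib_right right_diff_distrib mult.assoc)
    also have "\<dots> \<in> pS t"
    proof (intro pS_uminus pS_sum)
      fix j assume j: "j \<in> {1..t}"
      have split: "geom_power g (s - j) = geom_power g (t - j) * g ^ (p ^ (t - j))"
        using j by (simp add: geom_power_def t Suc_diff_le)
      have "(\<psi> ^^ j) (g ^ (p ^ (t - j))) - h \<in> pS (Suc (t - j))"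
        using frobenius_pow_power [OF assms(1), of j "t - j"] j by (simp add: h_def)
      then have "(\<psi> ^^ j) (geom_power g (t - j)) * ((\<psi> ^^ j) (g ^ (p ^ (t - j))) - h) \<in> pS (Suc (t - j))"
        by (intro pS_mult_left clo)
      moreover have "ghost_rest g j \<in> pS (j - 1)"
        using less.IH [of j] j t by auto
      ultimately have "ghost_rest g j * ((\<psi> ^^ j) (geom_power g (t - j)) * ((\<psi> ^^ j) (g ^ (p ^ (t - j))) - h)) \<in> pS ((j - 1) + Suc (t - j))"
        by (intro pS_mult)
      then show "ghost_rest g j * ((\<psi> ^^ j) (geom_power g (s - j)) - (\<psi> ^^ j) (geom_power g (t - j)) * h) \<in> pS t"
        using j by (simp add: split algebra_simps)
    qed
    finally show ?thesis by (simp add: t)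
  qed
qed

text \<open>Iteration gives \<open>A = geom_power g s * A ^ (p ^ s)\<close>, and the first factor is
  decomposed. Replacing \<open>(\<psi> ^^ j) (geom_power g (s - j)) * A ^ (p ^ s)\<close> by
  \<open>(\<psi> ^^ j) A\<close> costs a multiple of \<open>p ^ (s - j + 1)\<close>, and
  \<open>ghost_rest g j\<close> supplies the other \<open>j - 1\<close> factors.\<close>

lemma ghost_expansion:
  assumes g: "g \<in> S" and A: "A \<in> S" "A = g * A ^ p" and "s > 0"
  shows "A - (\<Sum>j = 1..s. ghost_rest g j * (\<psi> ^^ j) A) \<in> pS s"
proof -
  have fix_eq: "A = geom_power g n * A ^ (p ^ n)" for n
  proof (induction n)
    case (Suc n)
    have "A ^ (p ^ n) = (g * A ^ p) ^ (p ^ n)"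
      by (rule arg_cong [OF A(2)])
    also have "\<dots> = g ^ (p ^ n) * A ^ (p ^ Suc n)"
      by (simp add: power_mult_distrib flip: power_mult)
    finally have "geom_power g n * A ^ (p ^ n) = geom_power g (Suc n) * A ^ (p ^ Suc n)"
      by (simp add: geom_power_def mult.assoc)
    with Suc show ?case by (rule trans)
  qed (simp add: geom_power_def)
  have "A = (\<Sum>j = 1..s. ghost_rest g j * (\<psi> ^^ j) (geom_power g (s - j))) * A ^ (p ^ s)"
    unfolding geom_power_decomp [OF \<open>s > 0\<close>] by (rule fix_eq)
  then have "A - (\<Sum>j = 1..s. ghost_rest g j * (\<psi> ^^ j) A) =
      (\<Sum>j = 1..s. ghost_rest g j * (\<psi> ^^ j) (geom_power g (s - j))) * A ^ (p ^ s) -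
      (\<Sum>j = 1..s. ghost_rest g j * (\<psi> ^^ j) A)"
    by (rule arg_cong)
  also have "\<dots> =
     - (\<Sum>j = 1..s. ghost_rest g j * ((\<psi> ^^ j) A - (\<psi> ^^ j) (geom_power g (s - j)) * A ^ (p ^ s)))"
    by (simp add: sum_subtractf sum_distrib_right right_diff_distrib mult.assoc)
  also have "\<dots> \<in> pS s"
  proof (intro pS_uminus pS_sum)
    fix j assume j: "j \<in> {1..s}"
    \<comment> \<open>The iterated equation with exponent \<open>s - j\<close>, to which
      \<open>\<psi> ^^ j\<close> is applied.\<close>
    have "(\<psi> ^^ j) A = (\<psi> ^^ j) (geom_power g (s - j)) * (\<psi> ^^ j) (A ^ (p ^ (s - j)))"
      unfolding hom_pow.mult [symmetric] by (rule arg_cong [OF fix_eq])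
    then have "(\<psi> ^^ j) A - (\<psi> ^^ j) (geom_power g (s - j)) * A ^ (p ^ s) =
       (\<psi> ^^ j) (geom_power g (s - j)) * ((\<psi> ^^ j) (A ^ (p ^ (s - j))) - A ^ (p ^ s))"
      unfolding right_diff_distrib mult.assoc [symmetric] by (rule arg_cong)
    also have "\<dots> \<in> pS (Suc (s - j))"
      using frobenius_pow_power [OF A(1), of j "s - j"] j
      by (intro pS_mult_left endo_pow_closed geom_power_closed g) simp
    finally have "ghost_rest g j * ((\<psi> ^^ j) A - (\<psi> ^^ j) (geom_power g (s - j)) * A ^ (p ^ s)) \<in> pS ((j - 1) + Suc (s - j))"
      using j by (intro pS_mult ghost_rest_in_pS g) auto
    then show "ghost_rest g j * ((\<psi> ^^ j) A - (\<psi> ^^ j) (geom_power g (s - j)) * A ^ (p ^ s)) \<in> pS s"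
      using j by simp
  qed
  finally show ?thesis .
qed

text \<open>Modulo \<open>p S\<close> one may replace \<open>p\<^sup>i\<close>-th powers of the \<open>v\<close> already known to be integral by
  values of \<open>\<psi>\<close>, because \<open>l i\<close> has denominator at most \<open>p\<^sup>i\<close>.\<close>

lemma hazewinkel_integral:
  fixes l w v :: "nat \<Rightarrow> 'a" and u :: 'a
  assumes inv_p: "of_nat p * u = 1"
    and l0: "l 0 = 1"
    and l: "\<And>i. of_nat p ^ i * l i \<in> S"
    and w: "\<And>j. j > 0 \<Longrightarrow> w j \<in> S"
    and func: "\<And>s. s > 0 \<Longrightarrow> of_nat p * l s - (\<Sum>j = 1..s. w j * (\<psi> ^^ j) (l (s - j))) \<in> pS 1"
    and v: "\<And>k. k > 0 \<Longrightarrow> of_nat p * l k = (\<Sum>i<k. l i * v (k - i) ^ (p ^ i))"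
    and "k > 0"
  shows "v k \<in> S"
  using \<open>k > 0\<close>
proof (induction k rule: less_induct)
  case (less k)
  have vS: "v i \<in> S" if "i > 0" "i < k" for i
    using less that by blast
  \<comment> \<open>Inserting the functional equation for \<open>of_nat p * l i\<close> into the
    recursion for \<open>k\<close> gives \<open>T j\<close> as the factor of \<open>w j\<close>.
    Shifted by \<open>j\<close>, it is the recursion for \<open>k - j\<close> under
    \<open>\<psi> ^^ j\<close>, except that the powers of \<open>v\<close> are not
    transformed.\<close>
  define T where "T j = (\<Sum>i = j..<k. (\<psi> ^^ j) (l (i - j)) * v (k - i) ^ (p ^ i))" for j
  have T: "T j - (\<psi> ^^ j) (of_nat p * l (k - j)) \<in> pS 1" if j: "j \<in> {1..<k}" for j
  proof -
    have "T j = (\<Sum>i<k - j. (\<psi> ^^ j) (l i) * v (k - j - i) ^ (p ^ (i + j)))"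
      unfolding T_def using j
      by (intro sum.reindex_bij_witness [of _ "\<lambda>i. i + j" "\<lambda>i. i - j"]) auto
    moreover have "(\<psi> ^^ j) (of_nat p * l (k - j)) =
       (\<Sum>i<k - j. (\<psi> ^^ j) (l i) * (\<psi> ^^ j) (v (k - j - i) ^ (p ^ i)))"
      using j by (subst v) (auto simp: hom_pow.sum)
    ultimately have "T j - (\<psi> ^^ j) (of_nat p * l (k - j)) = 
       - (\<Sum>i<k - j. (\<psi> ^^ j) (l i) * ((\<psi> ^^ j) (v (k - j - i) ^ (p ^ i)) - v (k - j - i) ^ (p ^ (i + j))))"
      by (simp add: sum_subtractf algebra_simps)
    also have "\<dots> \<in> pS 1"
    proof (intro pS_uminus pS_sum)
      fix i assume i: "i \<in> {..<k - j}"
      have "v (k - j - i) \<in> S" using i j by (intro vS) auto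
      note frobenius_pow_power [OF this, of j i]
      then obtain y where y: "y \<in> S"
         "(\<psi> ^^ j) (v (k - j - i) ^ (p ^ i)) - v (k - j - i) ^ (p ^ (i + j)) = of_nat p ^ Suc i * y"
        by (rule pS_E)
      \<comment> \<open>Of the \<open>i + 1\<close> factors \<open>p\<close> in the congruence,
        \<open>i\<close> clear the denominator of \<open>l i\<close> and one remains.\<close>
      have "(\<psi> ^^ j) (of_nat p ^ i * l i) * y \<in> S"
        using y endo_pow_closed [OF l] by (intro mult_closed)
      then have "of_nat p * ((\<psi> ^^ j) (of_nat p ^ i * l i) * y) \<in> pS 1"
        by (rule pS_1I)
      then show "(\<psi> ^^ j) (l i) * ((\<psi> ^^ j) (v (k - j - i) ^ (p ^ i)) - v (k - j - i) ^ (p ^ (i + j))) \<in> pS 1"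
        unfolding y(2) by (simp add: mult.assoc mult.left_commute)
    qed
    finally show ?thesis .
  qed
  \<comment> \<open>The error term of the functional equation, which lies in \<open>pS 1\<close> for
    positive \<open>s\<close>.\<close>
  define E where "E s = of_nat p * l s - (\<Sum>j = 1..s. w j * (\<psi> ^^ j) (l (s - j)))" for s
  have pl: "of_nat p * l s = E s + (\<Sum>j = 1..s. w j * (\<psi> ^^ j) (l (s - j)))" for s
    by (simp add: E_def)
  have k: "{..<k} = insert 0 {1..<k}" "{1..k} = insert k {1..<k}"
    using less.prems by auto
  have swap: "(\<Sum>i = 1..<k. (\<Sum>j = 1..i. w j * (\<psi> ^^ j) (l (i - j))) * v (k - i) ^ (p ^ i))
      = (\<Sum>j = 1..<k. w j * T j)"
    unfolding T_def sum_distrib_left sum_distrib_right sum_triangle_swap mult.assoc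
    by (rule refl)
  have eq1: "of_nat p * v k = of_nat p * (of_nat p * l k) - (\<Sum>i = 1..<k. (of_nat p * l i) * v (k - i) ^ (p ^ i))"
  proof -
    have "of_nat p * l k = v k + (\<Sum>i = 1..<k. l i * v (k - i) ^ (p ^ i))"
      unfolding v [OF less.prems] k(1) by (simp add: l0)
    then have "of_nat p * (of_nat p * l k) =
        of_nat p * v k + (\<Sum>i = 1..<k. (of_nat p * l i) * v (k - i) ^ (p ^ i))"
      by (simp only: distrib_left sum_distrib_left mult.assoc)
    then show ?thesis by (simp only: add_diff_cancel_right')
  qed
  have eq2: "(\<Sum>i = 1..<k. (of_nat p * l i) * v (k - i) ^ (p ^ i)) =
      (\<Sum>i = 1..<k. E i * v (k - i) ^ (p ^ i)) + (\<Sum>j = 1..<k. w j * T j)"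
    unfolding swap [symmetric] pl distrib_right sum.distrib by (rule refl)
  have eq3: "of_nat p * (of_nat p * l k) = of_nat p * E k + of_nat p * w k + 
      (\<Sum>j = 1..<k. w j * (\<psi> ^^ j) (of_nat p * l (k - j)))"
  proof -
    have "of_nat p * l k = E k + (w k + (\<Sum>j = 1..<k. w j * (\<psi> ^^ j) (l (k - j))))"
      unfolding pl [of k] k(2) by (simp add: l0)
    then show ?thesis
      by (simp add: distrib_left sum_distrib_left ac_simps)
  qed
  \<comment> \<open>The terms outside \<open>S\<close> now occur only within the differences bounded
    by \<open>T\<close>; every summand on the right is divisible by \<open>p\<close> in
    \<open>S\<close>.\<close>
  have eq: "of_nat p * v k = of_nat p * (E k + w k) - (\<Sum>i = 1..<k. E i * v (k - i) ^ (p ^ i))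
      - (\<Sum>j = 1..<k. w j * (T j - (\<psi> ^^ j) (of_nat p * l (k - j))))"
    unfolding eq1 eq2 eq3 right_diff_distrib sum_subtractf distrib_left by simp
  have E: "E s \<in> pS 1" if "s > 0" for s
    using func [OF that] by (simp add: E_def)
  have "of_nat p * v k \<in> pS 1"
    unfolding eq
  proof (rule pS_diff [OF pS_diff])
    show "of_nat p * (E k + w k) \<in> pS 1"
      using less.prems by (intro pS_1I add_closed pS_subset [OF E] w)
    show "(\<Sum>i = 1..<k. E i * v (k - i) ^ (p ^ i)) \<in> pS 1"
      by (rule pS_sum, rule pS_mult_right) (auto intro!: E [unfolded One_nat_def] power_closed vS)
    show "(\<Sum>j = 1..<k. w j * (T j - (\<psi> ^^ j) (of_nat p * l (k - j)))) \<in> pS 1"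
      by (rule pS_sum, rule pS_mult_left [OF w T]) auto
  qed
  then obtain y where "y \<in> S" "of_nat p * v k = of_nat p * y"
    by (auto elim: pS_E)
  \<comment> \<open>Multiplication by the inverse \<open>u\<close> of \<open>p\<close> in the
    ambient ring cancels \<open>p\<close>.\<close>
  then have "u * (of_nat p * v k) = u * (of_nat p * y)" by simp
  with inv_p have "v k = y"
    by (simp flip: mult.assoc add: mult.commute)
  with \<open>y \<in> S\<close> show ?case by simp
qed

end

text \<open>Fermat's congruence holds for integers and extends to fractions because
  \<open>frobenius_elems\<close> is closed under products and under inverses in the subring.\<close>

lemma localized_ints_fermat:
  assumes "prime p" "x \<in> (localized_ints p :: 'a::field_char_0 set)"
  shows "\<exists>y\<in>localized_ints p. x - x ^ p = of_nat p * y"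
proof -
  interpret subring_of "localized_ints p :: 'a set"
    using assms by (intro subring_of_localized_ints)
  \<comment> \<open>With the identity as endomorphism, \<open>frobenius_elems\<close> consists of
    the solutions of Fermat's congruence.\<close>
  interpret subring_endo "localized_ints p :: 'a set" id p
    by standard (use assms in \<open>auto simp: ring_hom_on_def\<close>)
  obtain a b where x: "x = of_int a / of_int b" "\<not> int p dvd b"
    using assms(2) by (auto simp: localized_ints_def)
  have int: "of_int k \<in> frobenius_elems" for k
    by (cases k) (simp_all add: frobenius_elems_of_nat frobenius_elems_uminus del: of_nat_Suc)
  have "(1 / of_int b :: 'a) \<in> localized_ints p"
    unfolding localized_ints_def using x by (intro CollectI exI [of _ 1] exI [of _ b]) auto
  then have "1 / of_int b \<in> frobenius_elems"
    using x by (intro frobenius_elems_inverse [OF int [of b]]) auto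
  with int [of a] have "x \<in> frobenius_elems"
    using frobenius_elems_mult [of "of_int a" "1 / of_int b"] by (simp add: x)
  then show ?thesis
    by (auto simp: frobenius_elems_def pS_def)
qed

section \<open>Power series over a ring with a Frobenius lift\<close>

unbundle fps_syntax
no_notation vec_nth (infixl \<open>$\<close> 90)

section \<open>Maps on coefficients and the lift to power series\<close>

definition fps_map :: "('a \<Rightarrow> 'b) \<Rightarrow> 'a fps \<Rightarrow> 'b fps" where
  "fps_map h f = Abs_fps (\<lambda>n. h (f $ n))"

lemma fps_map_nth [simp]: "fps_map h f $ n = h (f $ n)"
  by (simp add: fps_map_def)

lemma unital_hom_fps_map:
  assumes "unital_hom h"
  shows "unital_hom (fps_map h)"
proof -
  interpret unital_hom h by fact
  show ?thesis
    by (rule unital_homI) (simp_all add: fps_eq_iff fps_mult_nth sum)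
qed

lemma fps_map_const [simp]: "unital_hom h \<Longrightarrow> fps_map h (fps_const c) = fps_const (h c)"
  by (simp add: fps_eq_iff unital_hom.zero)

lemma fps_map_X [simp]: "unital_hom h \<Longrightarrow> fps_map h fps_X = fps_X"
  by (simp add: fps_eq_iff fps_X_def unital_hom.zero unital_hom.one)

lemma fps_map_compose:
  assumes "unital_hom h"
  shows "fps_map h (f oo g) = fps_map h f oo fps_map h g"
proof -
  interpret unital_hom h by fact
  interpret F: unital_hom "fps_map h" by (rule unital_hom_fps_map) fact
  have "h (g ^ i $ n) = fps_map h g ^ i $ n" for i n
    by (simp flip: F.power)
  then show ?thesis
    by (simp add: fps_eq_iff fps_compose_nth sum)
qed

definition fps_over :: "'a::zero set \<Rightarrow> 'a fps set" where
  "fps_over S = {f. \<forall>n. f $ n \<in> S}"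

text \<open>Applies \<psi> to the coefficients and substitutes \<open>fps_X ^ q\<close> for
  \<open>fps_X\<close> when \<open>q > 0\<close>. The description by coefficients makes single
  coefficients of a product accessible.\<close>

definition fps_lift :: "nat \<Rightarrow> ('a \<Rightarrow> 'a) \<Rightarrow> 'a::zero fps \<Rightarrow> 'a fps" where
  "fps_lift q \<psi> f = Abs_fps (\<lambda>n. if q dvd n then \<psi> (f $ (n div q)) else 0)"

lemma fps_lift_nth: "fps_lift q \<psi> f $ n = (if q dvd n then \<psi> (f $ (n div q)) else 0)"
  by (simp add: fps_lift_def)

lemma fps_lift_funpow:
  assumes "\<psi> 0 = 0" "q > 0"
  shows "(fps_lift q \<psi> ^^ j) f = fps_lift (q ^ j) (\<psi> ^^ j) f"
proof (induction j)
  case (Suc j)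
  have "fps_lift q \<psi> (fps_lift (q ^ j) (\<psi> ^^ j) f) $ n = fps_lift (q ^ Suc j) (\<psi> ^^ Suc j) f $ n" for n
  proof (cases "q dvd n")
    case True
    then obtain m where "n = q * m" ..
    then show ?thesis
      using assms by (simp add: fps_lift_nth)
  next
    case False
    then have "\<not> q ^ Suc j dvd n"
      using dvd_mult_left by auto
    with False show ?thesis
      by (simp only: fps_lift_nth if_False)
  qed
  then have "fps_lift q \<psi> (fps_lift (q ^ j) (\<psi> ^^ j) f) = fps_lift (q ^ Suc j) (\<psi> ^^ Suc j) f"
    by (rule fps_ext)
  then show ?case
    by (simp only: funpow.simps(2) o_def Suc)
qed (simp add: fps_eq_iff fps_lift_nth)

lemma subring_of_fps_over:
  assumes "subring_of S"
  shows "subring_of (fps_over S)"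
proof -
  interpret subring_of S by fact
  show ?thesis
    by standard (auto simp: fps_over_def fps_mult_nth intro!: sum_closed)
qed

text \<open>In this form additivity and multiplicativity are inherited from composition of
  series.\<close>

lemma fps_lift_eq_compose:
  assumes "q > 0"
  shows "fps_lift q \<psi> f = fps_map \<psi> f oo fps_X ^ q"
proof (rule fps_ext)
  fix n
  have "(fps_map \<psi> f oo fps_X ^ q) $ n = (\<Sum>i = 0..n. if n = q * i then \<psi> (f $ i) else 0)"
    by (intro trans [OF fps_compose_nth] sum.cong refl)
      (simp flip: power_mult)
  also have "\<dots> = (\<Sum>i = 0..n. if q dvd n \<and> i = n div q then \<psi> (f $ i) else 0)"
    using assms by (intro sum.cong refl if_cong) auto
  also have "\<dots> = fps_lift q \<psi> f $ n"
    by (simp add: fps_lift_nth)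
  finally show "fps_lift q \<psi> f $ n = (fps_map \<psi> f oo fps_X ^ q) $ n" ..
qed

lemma unital_hom_fps_lift:
  fixes \<psi> :: "'a::idom \<Rightarrow> 'a"
  assumes "unital_hom \<psi>" "q > 0"
  shows "unital_hom (fps_lift q \<psi>)"
proof -
  interpret F: unital_hom "fps_map \<psi>" by (rule unital_hom_fps_map) fact
  show ?thesis
    using assms(2) by (intro unital_homI)
      (simp_all add: fps_lift_eq_compose fps_compose_add_distrib fps_compose_mult_distrib)
qed

text \<open>A coefficient of \<open>f ^ p\<close> depends on finitely many coefficients of
  \<open>f\<close>. So \<open>f\<close> may be truncated to a polynomial in \<open>fps_X\<close>,
  and the congruence checked on constants and on \<open>fps_X\<close>.\<close>

lemma frobenius_lift_fps:
  fixes S :: "'a::idom set"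
  assumes "frobenius_lift S \<psi> p"
  shows "frobenius_lift (fps_over S) (fps_lift p \<psi>) p"
    and "\<And>f n k. f \<in> subring_endo.pS (fps_over S) p n \<Longrightarrow> f $ k \<in> subring_endo.pS S p n"
proof -
  interpret frobenius_lift S \<psi> p by fact
  interpret F: subring_of "fps_over S"
    by (rule subring_of_fps_over) unfold_locales
  interpret F: unital_hom "fps_lift p \<psi>"
    by (rule unital_hom_fps_lift) (use prime_p prime_gt_0_nat in \<open>auto intro: hom.unital_hom_axioms\<close>)
  interpret F: subring_endo "fps_over S" "fps_lift p \<psi>" p
    by standard (auto simp: prime_p fps_over_def fps_lift_nth)
  have of_nat_mult_nth: "(of_nat p ^ n * f) $ k = of_nat p ^ n * f $ k" for n k and f :: "'a fps"
  proof -
    have "(of_nat p ^ n :: 'a fps) = fps_const (of_nat p ^ n)"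
      by (simp add: fps_of_nat flip: fps_const_power)
    then show ?thesis by simp
  qed
  show pS_nth: "f \<in> F.pS n \<Longrightarrow> f $ k \<in> pS n" for f n k
    by (erule F.pS_E) (simp add: fps_over_def of_nat_mult_nth pS_I)
  have pS_fps: "f \<in> F.pS n" if "\<And>k. f $ k \<in> pS n" for f n
  proof -
    have "\<exists>y\<in>S. f $ k = of_nat p ^ n * y" for k
      using that [of k] by (auto simp: pS_def)
    then obtain y where y: "\<And>k. y k \<in> S" "\<And>k. f $ k = of_nat p ^ n * y k"
      by metis
    then have "f = of_nat p ^ n * Abs_fps y"
      by (simp add: fps_eq_iff of_nat_mult_nth)
    moreover have "Abs_fps y \<in> fps_over S"
      using y(1) by (simp add: fps_over_def)
    ultimately show ?thesis
      using F.pS_I by metis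
  qed
  have const: "fps_const a \<in> F.frobenius_elems" if "a \<in> S" for a
  proof -
    have "fps_lift p \<psi> (fps_const a) - fps_const a ^ p = fps_const (\<psi> a - a ^ p)"
      using prime_gt_0_nat [OF prime_p]
      by (auto simp: fps_eq_iff fps_lift_nth dvd_div_eq_0_iff)
    moreover have "fps_const (\<psi> a - a ^ p) \<in> F.pS 1"
      using frobenius [OF that] by (intro pS_fps) (simp add: pS_zero)
    moreover have "fps_const a \<in> fps_over S"
      using that by (simp add: fps_over_def)
    ultimately show ?thesis
      by (simp add: F.frobenius_elems_def)
  qed
  have X: "fps_X \<in> F.frobenius_elems"
  proof -
    have "p > 0" "p \<noteq> 1" using prime_p prime_gt_0_nat by auto
    have "fps_lift p \<psi> fps_X = fps_X ^ p"
    proof (rule fps_ext)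
      fix n show "fps_lift p \<psi> fps_X $ n = fps_X ^ p $ n"
      proof (cases "p dvd n")
        case True
        then obtain m where "n = p * m" ..
        then show ?thesis using \<open>p > 0\<close> by (simp add: fps_lift_nth)
      next
        case False
        then show ?thesis by (auto simp: fps_lift_nth)
      qed
    qed
    moreover have "fps_X \<in> fps_over S"
      by (simp add: fps_over_def fps_X_def)
    ultimately show ?thesis
      by (simp add: F.frobenius_elems_def F.pS_zero)
  qed
  show "frobenius_lift (fps_over S) (fps_lift p \<psi>) p"
  proof
    fix f assume f: "f \<in> fps_over S"
    show "fps_lift p \<psi> f - f ^ p \<in> F.pS 1"
    proof (rule pS_fps)
      fix k
      \<comment> \<open>The truncation of \<open>f\<close> that keeps the indices up to
        \<open>k\<close>.\<close>
      define h where "h = (\<Sum>i<Suc k. fps_const (f $ i) * fps_X ^ i)"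
      have "h \<in> F.frobenius_elems"
        unfolding h_def using f
        by (intro F.frobenius_elems_sum F.frobenius_elems_mult F.frobenius_elems_power const X)
          (simp add: fps_over_def)
      then have "(fps_lift p \<psi> h - h ^ p) $ k \<in> pS 1"
        by (intro pS_nth) (simp add: F.frobenius_elems_def)
      moreover have h: "h $ i = f $ i" if "i < Suc k" for i
        using that by (simp add: h_def fps_sum_nth fps_X_power_iff if_distrib cong: if_cong)
      have "fps_cutoff (Suc k) h = fps_cutoff (Suc k) f"
        using h by (simp add: fps_eq_iff)
      then have "(h ^ n) $ i = (f ^ n) $ i" if "i < Suc k" for n i
        using that
      proof (induction n arbitrary: i)
        case (Suc n)
        then show ?case by (simp add: fps_mult_nth h)
      qed simp
      then have "h ^ p $ k = f ^ p $ k" by simp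
      moreover have "fps_lift p \<psi> h $ k = fps_lift p \<psi> f $ k"
        using h by (simp add: fps_lift_nth le_imp_less_Suc)
      ultimately show "(fps_lift p \<psi> f - f ^ p) $ k \<in> pS 1"
        by simp
    qed
  qed
qed

definition mpoly_frobenius :: "nat \<Rightarrow> ('x, 'a::comm_ring_1) mpoly \<Rightarrow> ('x, 'a) mpoly" where
  "mpoly_frobenius p = eval_mpoly mconst (\<lambda>i. mvar i ^ p)"

text \<open>On constants, which are fixed, the congruence is Fermat's; on variables it is an
  equality; and these generate all polynomials.\<close>

lemma frobenius_lift_mpoly:
  assumes "prime p"
  shows "frobenius_lift (mpolys_over (localized_ints p) :: ('x, 'a::field_char_0) mpoly set) (mpoly_frobenius p) p"
proof -
  let ?Z = "localized_ints p :: 'a set" and ?S = "mpolys_over (localized_ints p) :: ('x, 'a) mpoly set"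
  interpret Z: subring_of ?Z using assms by (rule subring_of_localized_ints)
  interpret subring_of ?S by (rule subring_of_mpolys_over) unfold_locales
  interpret C: unital_hom "mconst :: 'a \<Rightarrow> ('x, 'a) mpoly" by (rule unital_hom_mconst)
  interpret unital_hom "mpoly_frobenius p :: ('x, 'a) mpoly \<Rightarrow> _"
    unfolding mpoly_frobenius_def by (rule unital_hom_eval_mpoly) unfold_locales
  have var: "mvar i \<in> ?S" for i by (intro mvar_in_mpolys_over) auto
  have const: "mconst a \<in> ?S" if "a \<in> ?Z" for a using that by (intro mconst_in_mpolys_over) auto
  interpret subring_endo ?S "mpoly_frobenius p" p
  proof
    show "prime p" by fact
    show "mpoly_frobenius p F \<in> ?S" if "F \<in> ?S" for F
      unfolding mpoly_frobenius_def using that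
      by (intro eval_mpoly_closed power_closed var const) (simp add: mpolys_over_def)
  qed
  have "mconst a \<in> frobenius_elems" if a: "a \<in> ?Z" for a
  proof -
    obtain y where y: "y \<in> ?Z" "a - a ^ p = of_nat p * y"
      using localized_ints_fermat [OF assms a] by blast
    have "mpoly_frobenius p (mconst a) - (mconst a :: ('x, 'a) mpoly) ^ p = mconst (of_nat p * y)"
      unfolding y(2) [symmetric] by (simp add: mpoly_frobenius_def)
    then show ?thesis
      using const [OF y(1)] const [OF a] pS_1I by (simp add: frobenius_elems_def)
  qed
  moreover have "mvar i \<in> frobenius_elems" for i
  proof -
    have "mpoly_frobenius p (mvar i) = (mvar i ^ p :: ('x, 'a) mpoly)"
      by (simp add: mpoly_frobenius_def unital_hom_mconst)
    then show ?thesis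
      using var pS_zero by (simp add: frobenius_elems_def)
  qed
  ultimately have "eval_mpoly mconst mvar F \<in> frobenius_elems" if "F \<in> ?S" for F
    unfolding eval_mpoly_def using that
    by (intro frobenius_elems_sum frobenius_elems_mult frobenius_elems_prod frobenius_elems_power)
       (auto simp: mpolys_over_def)
  then show ?thesis
    by unfold_locales (simp add: eval_mpoly_mvar_id frobenius_elems_def)
qed

section \<open>Inverse cube roots of integral series\<close>

lemma fps_mult_nth_leading:
  fixes f g :: "'a::comm_ring_1 fps"
  assumes "\<And>k. k < n \<Longrightarrow> f $ k = 0"
  shows "(f * g) $ n = f $ n * g $ 0"
proof -
  have "(f * g) $ n = (\<Sum>i\<in>{0..n}. if i = n then f $ n * g $ 0 else 0)"
    unfolding fps_mult_nth using assms by (intro sum.cong) auto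
  then show ?thesis by simp
qed

text \<open>The coefficient of index \<open>n\<close> in \<open>A ^ 3 * P\<close> is \<open>3 * A $ n\<close> plus an integral polynomial in
  earlier coefficients of \<open>A\<close>.\<close>

lemma inverse_cube_root_integral:
  fixes A P :: "'a::comm_ring_1 fps"
  assumes S: "subring_of S" and t: "t \<in> S" "3 * t = 1"
    and A0: "A $ 0 = 1" and P: "P \<in> fps_over S" and AP: "A ^ 3 * P = 1"
  shows "A \<in> fps_over S"
proof -
  interpret subring_of S by fact
  interpret F: subring_of "fps_over S" by (rule subring_of_fps_over) fact
  have P0: "P $ 0 = 1"
    using arg_cong [OF AP, of "\<lambda>f. f $ 0"] A0 by (simp add: power3_eq_cube)
  have "A $ n \<in> S" for n
  proof (induction n rule: less_induct)
    case (less n)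
    show ?case
    proof (cases "n = 0")
      case True
      then show ?thesis by (simp add: A0)
    next
      case False
      \<comment> \<open>\<open>L\<close> is the part of \<open>A\<close> already known to be
        integral, and \<open>H\<close> starts at index \<open>n\<close>. At that index the terms of
        \<open>A ^ 3 * P\<close> of degree at least two in \<open>H\<close> vanish.\<close>
      define L where "L = fps_cutoff n A"
      define H where "H = A - L"
      have L: "L \<in> fps_over S" "L $ 0 = 1"
        using less False by (auto simp: fps_over_def L_def A0)
      have H: "H $ k = 0" if "k < n" for k using that by (simp add: H_def L_def)
      have Hn: "H $ n = A $ n" "H $ 0 = 0" using False by (simp_all add: H_def L_def A0)
      have "A = L + H" by (simp add: H_def)
      then have "A ^ 3 * P = L ^ 3 * P + H * (3 * L ^ 2 * P) + H * (H * (3 * L + H) * P)"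
        by (simp add: power3_eq_cube power2_eq_square algebra_simps)
      then have "0 = (L ^ 3 * P) $ n + (H * (3 * L ^ 2 * P)) $ n + (H * (H * (3 * L + H) * P)) $ n"
        using False unfolding AP by (metis fps_add_nth fps_one_nth)
      also have "\<dots> = (L ^ 3 * P) $ n + A $ n * 3"
        by (simp add: fps_mult_nth_leading [OF H] Hn L(2) P0 power2_eq_square)
      finally have "A $ n * 3 = - (L ^ 3 * P) $ n"
        by (simp add: eq_neg_iff_add_eq_0 add.commute)
      then have "A $ n * 3 * t = - (L ^ 3 * P) $ n * t"
        by (rule arg_cong)
      then have "A $ n = - (L ^ 3 * P) $ n * t"
        using t by (simp add: mult.assoc)
      moreover have "(L ^ 3 * P) $ n \<in> S"
        using F.mult_closed [OF F.power_closed [OF L(1)] P] by (simp add: fps_over_def)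
      ultimately show ?thesis
        using t by simp
    qed
  qed
  then show ?thesis by (simp add: fps_over_def)
qed

text \<open>Polynomials in the cube of the variable, of degree at most \<open>d\<close> in the
  variable itself. Both conditions together isolate a single product in
  \<open>coeff_prime_power_pred\<close>.\<close>

definition sparse_fps :: "nat \<Rightarrow> 'a::zero fps set" where
  "sparse_fps d = {f. \<forall>n. f $ n \<noteq> 0 \<longrightarrow> 3 dvd n \<and> n \<le> d}"

lemma sparse_fps_mult:
  fixes f g :: "'a::comm_ring_1 fps"
  assumes "f \<in> sparse_fps d" "g \<in> sparse_fps e"
  shows "f * g \<in> sparse_fps (d + e)"
  unfolding sparse_fps_def
proof (intro CollectI allI impI)
  fix n assume "(f * g) $ n \<noteq> 0"
  then obtain i where i: "i \<le> n" "f $ i * g $ (n - i) \<noteq> 0"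
    unfolding fps_mult_nth by (auto elim: sum.not_neutral_contains_not_neutral)
  then have "f $ i \<noteq> 0" "g $ (n - i) \<noteq> 0" by auto
  with assms have "3 dvd i" "i \<le> d" "3 dvd (n - i)" "n - i \<le> e"
    by (auto simp: sparse_fps_def)
  with i(1) show "3 dvd n \<and> n \<le> d + e"
    by presburger
qed

lemma sparse_fps_one: "1 \<in> sparse_fps d"
  by (simp add: sparse_fps_def)

lemma sparse_fps_power:
  fixes f :: "'a::comm_ring_1 fps"
  shows "f \<in> sparse_fps d \<Longrightarrow> f ^ n \<in> sparse_fps (n * d)"
  by (induction n) (simp_all add: sparse_fps_one sparse_fps_mult)

lemma sparse_fps_diff:
  fixes f g :: "'a::comm_ring_1 fps"
  shows "f \<in> sparse_fps d \<Longrightarrow> g \<in> sparse_fps d \<Longrightarrow> f - g \<in> sparse_fps d"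
  by (simp add: sparse_fps_def) (metis diff_self)

lemma sparse_fps_add:
  fixes f g :: "'a::comm_ring_1 fps"
  shows "f \<in> sparse_fps d \<Longrightarrow> g \<in> sparse_fps d \<Longrightarrow> f + g \<in> sparse_fps d"
  by (simp add: sparse_fps_def) (metis add_0)

lemma sparse_fps_sum:
  fixes f :: "'i \<Rightarrow> 'a::comm_ring_1 fps"
  shows "(\<And>i. i \<in> I \<Longrightarrow> f i \<in> sparse_fps d) \<Longrightarrow> sum f I \<in> sparse_fps d"
proof (induction I rule: infinite_finite_induct)
  case (insert i I)
  then show ?case by (simp add: sparse_fps_add)
qed (simp_all add: sparse_fps_def)

lemma sparse_fps_lift:
  assumes "f \<in> sparse_fps d" "\<psi> 0 = 0"
  shows "fps_lift q \<psi> f \<in> sparse_fps (q * d)"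
  unfolding sparse_fps_def
proof (intro CollectI allI impI)
  fix n assume "fps_lift q \<psi> f $ n \<noteq> 0"
  then have "q dvd n" "f $ (n div q) \<noteq> 0"
    using assms(2) by (auto simp: fps_lift_nth split: if_splits)
  with assms(1) have "n = q * (n div q)" "3 dvd n div q" "n div q \<le> d"
    by (auto simp: sparse_fps_def)
  then show "3 dvd n \<and> n \<le> q * d"
    by (metis dvd_mult mult_le_mono2)
qed

section \<open>Integrality of the Picard genus\<close>

text \<open>Generalizes \<open>fps_rat_power\<close> to any ring with a map \<open>h\<close> from
  the rationals, so that integrality can be proved over independent variables before passing to
  forms.\<close>

definition binom_power :: "(rat \<Rightarrow> 'b::comm_ring_1) \<Rightarrow> rat \<Rightarrow> 'b fps \<Rightarrow> 'b fps" where
  "binom_power h a G = fps_map h (fps_binomial a) oo (G - 1)"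

lemma fps_map_binom_power:
  assumes "unital_hom k"
  shows "fps_map k (binom_power h a G) = binom_power (k \<circ> h) a (fps_map k G)"
proof -
  interpret K: unital_hom "fps_map k" by (rule unital_hom_fps_map) fact
  have "fps_map k (fps_map h (fps_binomial a)) = fps_map (k \<circ> h) (fps_binomial a)"
    by (simp add: fps_eq_iff)
  then show ?thesis
    by (simp add: binom_power_def fps_map_compose [OF assms])
qed

lemma fps_rat_power_eq: "fps_rat_power a G = binom_power (form_const \<circ> of_rat) a G"
  by (simp add: fps_rat_power_def binom_power_def fps_map_def)

text \<open>The identity holds for the rational binomial series; \<open>h\<close> transports it, and
  composition with \<open>G - 1\<close>, which has constant term 0, respects products.\<close>

lemma binom_power_neg_third:
  fixes h :: "rat \<Rightarrow> 'b::idom"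
  assumes "unital_hom h" "G $ 0 = 1"
  shows "binom_power h (-1/3) G ^ 3 * G = 1"
proof -
  interpret h: unital_hom "fps_map h" by (rule unital_hom_fps_map) fact
  have c0: "(G - 1) $ 0 = 0" using assms(2) by simp
  have "fps_binomial (-1/3) ^ 3 * (1 + fps_X) = (1 :: rat fps)"
    by (simp add: fps_binomial_power fps_binomial_minus_one inverse_mult_eq_1)
  then have "fps_map h (fps_binomial (-1/3) ^ 3 * (1 + fps_X)) = 1"
    by (simp only: h.one)
  then have "fps_map h (fps_binomial (-1/3)) ^ 3 * (1 + fps_X) oo (G - 1) = 1 oo (G - 1)"
    using assms(1) by simp
  then show ?thesis
    unfolding fps_compose_mult_distrib [OF c0] fps_compose_power [OF c0, symmetric] fps_compose_add_distrib
    by (simp add: binom_power_def fps_X_fps_compose_startby0 [OF c0])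
qed

lemma binom_power_nth_0 [simp]: "unital_hom h \<Longrightarrow> binom_power h a G $ 0 = 1"
  by (simp add: binom_power_def unital_hom.one)

text \<open>This is \<open>P\<close>. As a product over the whole index type, its invariance under
  permutations is a reindexing.\<close>

definition picard_poly :: "(3 \<Rightarrow> 'b::comm_ring_1) \<Rightarrow> 'b fps" where
  "picard_poly x = (\<Prod>i\<in>UNIV. 1 - fps_const (x i) * fps_X ^ 3)"

lemma UNIV_3_eq: "(UNIV :: 3 set) = {0, 1, 2}"
  unfolding UNIV_3 by auto

lemma picard_poly_eq:
  "picard_poly x = (1 - fps_const (x 0) * fps_X ^ 3) * (1 - fps_const (x 1) * fps_X ^ 3) *
     (1 - fps_const (x 2) * fps_X ^ 3)"
  unfolding picard_poly_def UNIV_3_eq by (simp add: mult.assoc)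

lemma picard_poly_nth_0 [simp]: "picard_poly x $ 0 = 1"
  by (simp add: picard_poly_eq)

lemma fps_map_picard_poly:
  assumes "unital_hom k"
  shows "fps_map k (picard_poly x) = picard_poly (k \<circ> x)"
proof -
  interpret K: unital_hom "fps_map k" by (rule unital_hom_fps_map) fact
  show ?thesis
    by (simp add: picard_poly_def K.prod assms)
qed

lemma picard_poly_permute: "bij \<tau> \<Longrightarrow> picard_poly (x \<circ> \<tau>) = picard_poly x"
  unfolding picard_poly_def o_def by (rule prod.reindex_bij_betw)

lemma picard_poly_over:
  assumes "subring_of S" "\<And>i. x i \<in> S"
  shows "picard_poly x \<in> fps_over S"
proof -
  interpret subring_of S by fact
  interpret F: subring_of "fps_over S" by (rule subring_of_fps_over) fact
  have "fps_const (x i) \<in> fps_over S" for i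
    using assms(2) by (simp add: fps_over_def)
  moreover have "fps_X \<in> fps_over S"
    by (simp add: fps_over_def fps_X_def)
  ultimately show ?thesis
    unfolding picard_poly_def by (intro F.prod_closed) simp
qed

lemma picard_poly_sparse: "picard_poly x \<in> sparse_fps 9"
proof -
  have "fps_const (x i) * fps_X ^ 3 \<in> sparse_fps 3" for i
    unfolding sparse_fps_def by (simp add: fps_X_power_iff)
  then have "1 - fps_const (x i) * fps_X ^ 3 \<in> sparse_fps 3" for i
    by (intro sparse_fps_diff sparse_fps_one)
  then have "picard_poly x \<in> sparse_fps (3 + 3 + 3)"
    unfolding picard_poly_eq by (intro sparse_fps_mult)
  then show ?thesis by simp
qed

section \<open>The derivative of the logarithm over independent variables\<close>

lemma unital_hom_of_rat: "unital_hom (of_rat :: rat \<Rightarrow> 'a::field_char_0)"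
  by (rule unital_homI) (simp_all add: of_rat_add of_rat_mult)

abbreviation rat_const :: "rat \<Rightarrow> (3, complex) mpoly" where
  "rat_const \<equiv> mconst \<circ> of_rat"

lemma unital_hom_rat_const: "unital_hom rat_const"
  by (intro unital_hom_comp unital_hom_mconst unital_hom_of_rat)

definition picard_log_deriv :: "(3, complex) mpoly fps" where
  "picard_log_deriv = binom_power rat_const (-1/3) (picard_poly mvar)"

lemma picard_log_deriv_nth_0 [simp]: "picard_log_deriv $ 0 = 1"
  by (simp add: picard_log_deriv_def unital_hom_rat_const)

lemma picard_log_deriv_cube: "picard_log_deriv ^ 3 * picard_poly mvar = 1"
  unfolding picard_log_deriv_def by (intro binom_power_neg_third unital_hom_rat_const) simp

text \<open>As \<open>p\<close> is 1 modulo 3 it differs from 3, so 3 is invertible in the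
  \<open>p\<close>-local integers and the inverse cube root of \<open>P\<close> is integral.\<close>

lemma picard_log_deriv_integral:
  assumes "prime p" "[p = 1] (mod 3)"
  shows "picard_log_deriv \<in> fps_over (mpolys_over (localized_ints p))"
proof -
  interpret Z: subring_of "localized_ints p :: complex set"
    using assms(1) by (rule subring_of_localized_ints)
  have "\<not> p dvd 3"
  proof
    assume "p dvd 3"
    then have "p \<le> 3" by (rule dvd_imp_le) simp
    moreover have "p mod 3 = 1" using assms(2) by (simp add: cong_def)
    ultimately have "p = 1" by presburger
    with assms(1) show False by simp
  qed
  then have "(1 / of_nat 3 :: complex) \<in> localized_ints p"
    by (rule inverse_of_nat_in_localized_ints)
  then have t: "(mconst (1 / 3) :: (3, complex) mpoly) \<in> mpolys_over (localized_ints p)"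
    by (intro mconst_in_mpolys_over) auto
  have t3: "3 * (mconst (1 / 3) :: (3, complex) mpoly) = 1"
  proof -
    interpret C: unital_hom "mconst :: complex \<Rightarrow> (3, complex) mpoly" by (rule unital_hom_mconst)
    have "(mconst (of_nat 3 * (1 / 3)) :: (3, complex) mpoly) = of_nat 3 * mconst (1 / 3)"
      by (simp only: C.mult C.of_nat)
    then show ?thesis by simp
  qed
  have S: "subring_of (mpolys_over (localized_ints p) :: (3, complex) mpoly set)"
    by (rule subring_of_mpolys_over) unfold_locales
  have "picard_poly mvar \<in> fps_over (mpolys_over (localized_ints p) :: (3, complex) mpoly set)"
    by (intro picard_poly_over S mvar_in_mpolys_over) auto
  then show ?thesis
    by (rule inverse_cube_root_integral [OF S t t3 picard_log_deriv_nth_0 _ picard_log_deriv_cube])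
qed

text \<open>An index \<open>a\<close> of \<open>R\<close> can contribute only if \<open>a + 1 = c * p ^ j\<close>. The support of \<open>R\<close> forces
  \<open>c < 3\<close> and \<open>c\<close> to be 1 modulo 3.\<close>

lemma coeff_prime_power_pred:
  fixes R A :: "'a::comm_ring_1 fps"
  assumes p: "p mod 3 = (1::nat)" and R: "R \<in> sparse_fps (3 * (p ^ j - 1))" and j: "j \<le> s"
  shows "(R * fps_lift (p ^ j) \<psi> A) $ (p ^ s - 1) = R $ (p ^ j - 1) * \<psi> (A $ (p ^ (s - j) - 1))"
proof -
  have "p > 0" using p by (cases p) auto
  define q where "q = p ^ j"
  define r where "r = p ^ (s - j)"
  have ps: "p ^ s = q * r" using j by (simp add: q_def r_def flip: power_add)
  have pos: "q > 0" "r > 0" using \<open>p > 0\<close> by (auto simp: q_def r_def)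
  have q3: "q mod 3 = 1" using power_mod [of p 3 j] p by (simp add: q_def)
  have zero: "R $ a * fps_lift q \<psi> A $ (q * r - 1 - a) = 0" if a: "a \<le> q * r - 1" "a \<noteq> q - 1" for a
  proof (rule ccontr)
    assume *: "R $ a * fps_lift q \<psi> A $ (q * r - 1 - a) \<noteq> 0"
    then have "R $ a \<noteq> 0" by auto
    then have a3: "a mod 3 = 0" "a \<le> 3 * (q - 1)"
      using R by (auto simp: sparse_fps_def q_def)
    from * have "q dvd q * r - 1 - a" by (auto simp: fps_lift_nth split: if_splits)
    then obtain b where "q * r - 1 - a = q * b" ..
    moreover have "q * r > 0" using pos by simp
    ultimately have eq: "q * r = Suc a + q * b" using a(1) by linarith
    then have "q * b < q * r" by simp
    then have "b < r" using pos by simp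
    then obtain c where c: "r = b + c" "c > 0" by (metis less_imp_add_positive)
    then have ac: "q * c = Suc a" using eq by (simp add: distrib_left)
    \<comment> \<open>The degree bound on \<open>R\<close> enters here: \<open>Suc a\<close> is at
      most \<open>3 * q - 2\<close>.\<close>
    then have "q * c < q * 3" using a3 pos by linarith
    then have "c < 3" using pos by simp
    moreover have "c mod 3 = 1"
    proof -
      have "c mod 3 = (q mod 3) * c mod 3" using q3 by simp
      also have "\<dots> = Suc a mod 3" by (simp only: mod_mult_left_eq ac)
      finally show ?thesis using a3(1) by presburger
    qed
    ultimately have "c = 1" by simp
    with ac a(2) show False by simp
  qed
  have le: "q - 1 \<le> q * r - 1"
    using pos by (simp add: diff_le_mono)
  have diff: "q * r - 1 - (q - 1) = q * (r - 1)"
    using pos by (simp add: diff_mult_distrib2)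
  have "(R * fps_lift q \<psi> A) $ (q * r - 1) =
      (\<Sum>a = 0..q * r - 1. if a = q - 1 then R $ (q - 1) * fps_lift q \<psi> A $ (q * (r - 1)) else 0)"
    unfolding fps_mult_nth
  proof (intro sum.cong refl)
    fix a assume a: "a \<in> {0..q * r - 1}"
    show "R $ a * fps_lift q \<psi> A $ (q * r - 1 - a) =
        (if a = q - 1 then R $ (q - 1) * fps_lift q \<psi> A $ (q * (r - 1)) else 0)"
    proof (cases "a = q - 1")
      case True
      show ?thesis unfolding True diff by simp
    next
      case False
      have "a \<le> q * r - 1" using a by simp
      then show ?thesis unfolding if_not_P [OF False] by (rule zero [OF _ False])
    qed
  qed
  also have "\<dots> = R $ (q - 1) * \<psi> (A $ (r - 1))"
    using le pos by (simp add: fps_lift_nth)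
  finally show ?thesis
    by (simp add: ps q_def r_def)
qed

text \<open>The bound is additive along the recursion: \<open>p ^ j - 1\<close> and
  \<open>p ^ j * (p ^ (s - j) - 1)\<close> add up to \<open>p ^ s - 1\<close>. The family
  \<open>T\<close> is abstract because the ring of the locale is; it becomes
  \<open>sparse_fps\<close>, with \<open>c = 3\<close>.\<close>

lemma (in frobenius_lift) ghost_rest_sparse:
  assumes "\<And>f d j. f \<in> T d \<Longrightarrow> (\<psi> ^^ j) f \<in> T (p ^ j * d)"
    and "\<And>f g d e. f \<in> T d \<Longrightarrow> g \<in> T e \<Longrightarrow> f * g \<in> T (d + e)"
    and "\<And>f g d. f \<in> T d \<Longrightarrow> g \<in> T d \<Longrightarrow> f - g \<in> T d"
    and "\<And>f d (I :: nat set). (\<And>i. i \<in> I \<Longrightarrow> f i \<in> T d) \<Longrightarrow> sum f I \<in> T d"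
    and "\<And>d. 1 \<in> T d" and "\<And>f n d. f \<in> T d \<Longrightarrow> f ^ n \<in> T (n * d)"
    and g: "g \<in> T (c * (p - 1))" and "s > 0"
  shows "ghost_rest g s \<in> T (c * (p ^ s - 1))"
proof -
  have p: "p > 0" using prime_gt_0_nat [OF prime_p] .
  have Q: "geom_power g s \<in> T (c * (p ^ s - 1))" for s
  proof (induction s)
    case (Suc s)
    have "geom_power g s * g ^ (p ^ s) \<in> T (c * (p ^ s - 1) + p ^ s * (c * (p - 1)))"
      by (intro assms(2) Suc assms(6) g)
    also have "c * (p ^ s - 1) + p ^ s * (c * (p - 1)) = c * ((p ^ s - 1) + p ^ s * (p - 1))"
      by (simp add: algebra_simps)
    also have "(p ^ s - 1) + p ^ s * (p - 1) = p ^ Suc s - 1"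
      using p by (simp add: diff_mult_distrib2 mult.commute)
    finally show ?case by (simp add: geom_power_def)
  qed (simp add: geom_power_def assms)
  show ?thesis
    using \<open>s > 0\<close>
  proof (induction s rule: less_induct)
    case (less s)
    have "ghost_rest g j * (\<psi> ^^ j) (geom_power g (s - j)) \<in> T (c * (p ^ s - 1))" if j: "j \<in> {1..<s}" for j
    proof -
      have "ghost_rest g j * (\<psi> ^^ j) (geom_power g (s - j)) \<in>
          T (c * (p ^ j - 1) + p ^ j * (c * (p ^ (s - j) - 1)))"
        using j by (intro assms(1,2) Q less.IH) auto
      also have "c * (p ^ j - 1) + p ^ j * (c * (p ^ (s - j) - 1)) =
          c * ((p ^ j - 1) + p ^ j * (p ^ (s - j) - 1))"
        by (simp add: algebra_simps)
      also have "(p ^ j - 1) + p ^ j * (p ^ (s - j) - 1) = p ^ s - 1"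
        using p j power_increasing [of j s p] by (simp add: diff_mult_distrib2 flip: power_add)
      finally show ?thesis .
    qed
    then show ?case
      by (subst ghost_rest.simps) (intro assms(3,4) Q)
  qed
qed

text \<open>The genus with values in independent variables: each class \<open>CP n\<close> goes to
  the coefficient of index \<open>n\<close> of the derivative of the logarithm.\<close>

definition picard_hom :: "MUQ \<Rightarrow> (3, complex) mpoly" where
  "picard_hom = eval_mpoly rat_const (\<lambda>n. picard_log_deriv $ Suc n)"

interpretation picard_hom: unital_hom picard_hom
  unfolding picard_hom_def by (intro unital_hom_eval_mpoly unital_hom_rat_const)

lemma picard_hom_CP: "picard_hom (CP n) = picard_log_deriv $ n"
  by (cases n) (simp_all add: CP_def, simp add: picard_hom_def unital_hom_rat_const)

lemma picard_hom_mconst: "picard_hom (mconst a) = mconst (of_rat a)"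
  by (simp add: picard_hom_def mconst_def [of 0])

text \<open>An instance of \<open>hazewinkel_integral\<close>: \<open>l s\<close> is
  \<open>b s / p ^ s\<close>, where \<open>b s\<close> is the image of
  \<open>CP (p ^ s - 1)\<close>. The functional equation is the coefficient of index
  \<open>p ^ s - 1\<close> in \<open>ghost_expansion\<close>, by the degree bound on
  \<open>R j\<close>.\<close>

lemma picard_hom_hazewinkel_integral:
  assumes "prime p" "[p = 1] (mod 3)" "k > 0"
  shows "picard_hom (hazewinkel p k) \<in> mpolys_over (localized_ints p)"
proof -
  let ?S = "mpolys_over (localized_ints p) :: (3, complex) mpoly set"
  let ?\<psi> = "mpoly_frobenius p :: (3, complex) mpoly \<Rightarrow> _"
  let ?A = "picard_log_deriv"
  have p3: "p mod 3 = 1" using assms(2) by (simp add: cong_def)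
  have p: "p > 0" using assms(1) by (rule prime_gt_0_nat)
  have lift: "frobenius_lift ?S ?\<psi> p" by (rule frobenius_lift_mpoly) fact
  interpret frobenius_lift ?S ?\<psi> p by (rule lift)
  interpret F: frobenius_lift "fps_over ?S" "fps_lift p ?\<psi>" p
    by (rule frobenius_lift_fps) (rule lift)
  have A: "?A \<in> fps_over ?S" using assms by (intro picard_log_deriv_integral)
  \<comment> \<open>The division is exact since \<open>p\<close> is 1 modulo 3. In
    \<open>A ^ p = A * (A ^ 3) ^ N\<close> every cube then cancels one factor
    \<open>P\<close>.\<close>
  define N where "N = (p - 1) div 3"
  have N: "p - 1 = 3 * N" using p3 unfolding N_def by presburger
  define g where "g = picard_poly (mvar :: 3 \<Rightarrow> (3, complex) mpoly) ^ N"
  have g: "g \<in> fps_over ?S"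
    unfolding g_def by (intro F.power_closed picard_poly_over subring_of_axioms mvar_in_mpolys_over)
      (auto intro: subring_of.zero_closed subring_of.one_closed subring_of_localized_ints assms(1))
  have "g * ?A ^ p = ?A * (?A ^ 3 * picard_poly mvar) ^ N"
  proof -
    have "?A ^ p = ?A * (?A ^ 3) ^ N"
      using p by (simp flip: power_mult N power_Suc)
    then show ?thesis
      by (simp add: g_def power_mult_distrib ac_simps)
  qed
  then have Ag: "?A = g * ?A ^ p"
    by (simp add: picard_log_deriv_cube)
  define R where "R j = F.ghost_rest g j" for j
  have R_sparse: "R j \<in> sparse_fps (3 * (p ^ j - 1))" if "j > 0" for j
    unfolding R_def
  proof (rule F.ghost_rest_sparse [where T = sparse_fps, OF _ _ _ _ _ _ _ that])
    show "(fps_lift p ?\<psi> ^^ j) f \<in> sparse_fps (p ^ j * d)" if "f \<in> sparse_fps d" for f d j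
      unfolding fps_lift_funpow [of ?\<psi>, OF hom.zero p]
      by (intro sparse_fps_lift that) simp
    \<comment> \<open>\<open>P\<close> has degree at most 9, so \<open>g\<close> has degree at most
      \<open>9 * N = 3 * (p - 1)\<close>.\<close>
    have "g \<in> sparse_fps (N * 9)"
      unfolding g_def by (intro sparse_fps_power picard_poly_sparse)
    moreover have "N * 9 = 3 * (p - 1)"
      by (simp only: N mult_ac)
    ultimately show "g \<in> sparse_fps (3 * (p - 1))"
      by (simp only:)
  qed (simp_all add: sparse_fps_mult sparse_fps_diff sparse_fps_sum sparse_fps_one sparse_fps_power)
  define b where "b s = ?A $ (p ^ s - 1)" for s
  have b: "b s \<in> ?S" for s using A by (simp add: b_def fps_over_def)
  define \<gamma> where "\<gamma> j = R j $ (p ^ j - 1)" for j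
  have \<gamma>: "\<gamma> j \<in> pS (j - 1)" if "j > 0" for j
    unfolding \<gamma>_def R_def using frobenius_lift_fps(2) [OF lift F.ghost_rest_in_pS [OF g that]] .
  have rec: "b s - (\<Sum>j = 1..s. \<gamma> j * (?\<psi> ^^ j) (b (s - j))) \<in> pS s" if "s > 0" for s
  proof -
    have "(?A - (\<Sum>j = 1..s. R j * (fps_lift p ?\<psi> ^^ j) ?A)) $ (p ^ s - 1) \<in> pS s"
      unfolding R_def by (intro frobenius_lift_fps(2) [OF lift] F.ghost_expansion g A Ag that)
    moreover have "(R j * (fps_lift p ?\<psi> ^^ j) ?A) $ (p ^ s - 1) = \<gamma> j * (?\<psi> ^^ j) (b (s - j))"
      if "j \<in> {1..s}" for j
      unfolding \<gamma>_def b_def fps_lift_funpow [of ?\<psi>, OF hom.zero p]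
      using that by (intro coeff_prime_power_pred p3 R_sparse) auto
    ultimately show ?thesis
      by (simp add: b_def fps_sum_nth)
  qed
  define u where "u = (mconst (1 / of_nat p) :: (3, complex) mpoly)"
  interpret C: unital_hom "mconst :: complex \<Rightarrow> (3, complex) mpoly" by (rule unital_hom_mconst)
  have pu: "of_nat p * u = 1"
    unfolding u_def C.of_nat [symmetric] C.mult [symmetric] using p by simp
  then have pu_pow: "of_nat p ^ n * u ^ n = 1" for n
    by (simp flip: power_mult_distrib)
  have \<psi>u: "(?\<psi> ^^ j) (u ^ n) = u ^ n" for j n
  proof -
    have "?\<psi> u = u" by (simp add: u_def mpoly_frobenius_def)
    then have "(?\<psi> ^^ j) u = u" by (induction j) auto
    then show ?thesis by simp
  qed
  define l where "l s = u ^ s * b s" for s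
  \<comment> \<open>Dividing \<open>\<gamma> j\<close> by \<open>p ^ (j - 1)\<close> rather than by
    \<open>p ^ j\<close> is what leaves the factor \<open>p\<close> in front of \<open>l s\<close>
    in the functional equation.\<close>
  have "\<exists>w. \<forall>j>0. w j \<in> ?S \<and> \<gamma> j = of_nat p ^ (j - 1) * w j"
    using \<gamma> by (intro choice) (auto simp: pS_def)
  then obtain w where w: "\<And>j. j > 0 \<Longrightarrow> w j \<in> ?S" "\<And>j. j > 0 \<Longrightarrow> \<gamma> j = of_nat p ^ (j - 1) * w j"
    by blast
  show ?thesis
  proof (rule hazewinkel_integral [where u = u and l = l and w = w and v = "\<lambda>k. picard_hom (hazewinkel p k)"])
    show "of_nat p * u = 1" by fact
    show "l 0 = 1" by (simp add: l_def b_def)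
    show "of_nat p ^ i * l i \<in> ?S" for i
      using b [of i] by (simp add: l_def pu_pow flip: mult.assoc)
    show "w j \<in> ?S" if "j > 0" for j using w that by blast
    show "k > 0" by fact
    have l: "picard_hom (bp_log p i) = l i" for i
    proof -
      have "mconst (of_rat (1 / of_nat (p ^ i))) = u ^ i"
        by (simp add: u_def power_one_over of_rat_divide of_rat_power flip: C.power)
      then show ?thesis
        by (simp add: bp_log_def picard_hom_CP picard_hom_mconst l_def b_def)
    qed
    show "of_nat p * l k = (\<Sum>i<k. l i * picard_hom (hazewinkel p (k - i)) ^ (p ^ i))" if "k > 0" for k
      using arg_cong [OF hazewinkel_recursion [OF that, of p], of picard_hom]
      by (simp add: picard_hom.sum l)
    show "of_nat p * l s - (\<Sum>j = 1..s. w j * (?\<psi> ^^ j) (l (s - j))) \<in> pS 1" if s: "s > 0" for s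
    proof -
      obtain y where y: "y \<in> ?S" "b s - (\<Sum>j = 1..s. \<gamma> j * (?\<psi> ^^ j) (b (s - j))) = of_nat p ^ s * y"
        using rec [OF s] by (rule pS_E)
      have summand: "w j * (?\<psi> ^^ j) (l (s - j)) = of_nat p * u ^ s * (\<gamma> j * (?\<psi> ^^ j) (b (s - j)))"
        if j: "j \<in> {1..s}" for j
      proof -
        have "of_nat p * u ^ s * \<gamma> j = (of_nat p ^ Suc (j - 1) * u ^ j) * u ^ (s - j) * w j"
        proof -
          have "u ^ s = u ^ j * u ^ (s - j)" using j by (simp flip: power_add)
          moreover have "\<gamma> j = of_nat p ^ (j - 1) * w j" using j by (intro w(2)) simp
          ultimately show ?thesis by (simp only: power_Suc ac_simps)
        qed
        also have "\<dots> = u ^ (s - j) * w j"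
          using j by (simp add: pu_pow del: power_Suc)
        finally show ?thesis
          by (simp add: l_def \<psi>u hom_pow.mult ac_simps del: hom_pow.power)
      qed
      have "(\<Sum>j = 1..s. w j * (?\<psi> ^^ j) (l (s - j))) =
          of_nat p * u ^ s * (\<Sum>j = 1..s. \<gamma> j * (?\<psi> ^^ j) (b (s - j)))"
        unfolding sum_distrib_left by (intro sum.cong refl summand)
      then have "of_nat p * l s - (\<Sum>j = 1..s. w j * (?\<psi> ^^ j) (l (s - j))) =
          of_nat p * u ^ s * (b s - (\<Sum>j = 1..s. \<gamma> j * (?\<psi> ^^ j) (b (s - j))))"
        by (simp only: l_def right_diff_distrib mult.assoc)
      also have "\<dots> = of_nat p * (of_nat p ^ s * u ^ s) * y"
        unfolding y(2) by (simp add: ac_simps)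
      also have "\<dots> \<in> pS 1"
        using y(1) pS_1I by (simp add: pu_pow)
      finally show ?thesis .
    qed
  qed
qed

section \<open>Symmetric polynomials in three variables\<close>

text \<open>The type \<open>3\<close> is ordered by the representatives 0, 1, 2, which makes
  variable 0 the first in the lexicographic order.\<close>

lemma less_3_iff: "(k :: 3) < 1 \<longleftrightarrow> k = 0" "(k :: 3) < 2 \<longleftrightarrow> k = 0 \<or> k = 1" "\<not> (k :: 3) < 0"
proof -
  have "k \<in> {0, 1, 2}" using UNIV_3_eq by blast
  then show "k < 1 \<longleftrightarrow> k = 0" "k < 2 \<longleftrightarrow> k = 0 \<or> k = 1" "\<not> k < 0"
    by (auto simp: less_bit1_def bit1.Rep_0 bit1.Rep_1 bit1.Rep_numeral)
qed

lemma lookup_mconst_mult: "Poly_Mapping.lookup (mconst c * F) k = c * Poly_Mapping.lookup F k"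
proof -
  have "mconst c * F = (\<Sum>m\<in>Poly_Mapping.keys F. Poly_Mapping.single m (c * Poly_Mapping.lookup F m))"
    by (subst mpoly_eq_sum_single [of F, symmetric]) (simp add: sum_distrib_left mconst_def mult_single)
  then show ?thesis
    by (simp add: lookup_sum lookup_single when_def in_keys_iff)
qed

section \<open>Action of permutations on polynomials\<close>

definition mpermute :: "('x \<Rightarrow> 'x) \<Rightarrow> ('x, 'a::comm_ring_1) mpoly \<Rightarrow> ('x, 'a) mpoly" where
  "mpermute \<tau> = eval_mpoly mconst (mvar \<circ> \<tau>)"

definition permute_exps :: "('x \<Rightarrow> 'x) \<Rightarrow> ('x \<Rightarrow>\<^sub>0 nat) \<Rightarrow> 'x \<Rightarrow>\<^sub>0 nat" where
  "permute_exps \<tau> m = (\<Sum>i\<in>Poly_Mapping.keys m. Poly_Mapping.single (\<tau> i) (Poly_Mapping.lookup m i))"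

lemma lookup_permute_exps:
  "inj \<tau> \<Longrightarrow> Poly_Mapping.lookup (permute_exps \<tau> m) (\<tau> i) = Poly_Mapping.lookup m i"
  by (simp add: permute_exps_def lookup_sum lookup_single when_def inj_eq in_keys_iff)

lemma permute_exps_eq_iff: "inj \<tau> \<Longrightarrow> permute_exps \<tau> m = permute_exps \<tau> n \<longleftrightarrow> m = n"
  by (metis lookup_permute_exps poly_mapping_eqI)

lemma unital_hom_mpermute: "unital_hom (mpermute \<tau>)"
  unfolding mpermute_def by (intro unital_hom_eval_mpoly unital_hom_mconst)

lemma mpermute_mvar [simp]: "mpermute \<tau> (mvar i) = mvar (\<tau> i)"
  by (simp add: mpermute_def unital_hom_mconst)

lemma mpermute_mconst [simp]: "mpermute \<tau> (mconst a) = mconst a"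
  by (simp add: mpermute_def mconst_def [of 0])

text \<open>For injective \<tau> distinct monomials stay distinct, so no coefficients are
  merged.\<close>

lemma lookup_mpermute:
  assumes "inj \<tau>"
  shows "Poly_Mapping.lookup (mpermute \<tau> F) (permute_exps \<tau> m) = Poly_Mapping.lookup F m"
proof -
  have "monom_eval (\<lambda>i. mvar (\<tau> i)) n = (Poly_Mapping.single (permute_exps \<tau> n) 1 :: ('a, 'b) mpoly)" for n
    by (simp add: monom_eval_def mvar_power prod_single_one permute_exps_def)
  then have "mpermute \<tau> F = (\<Sum>n\<in>Poly_Mapping.keys F. Poly_Mapping.single (permute_exps \<tau> n) (Poly_Mapping.lookup F n))"
    by (simp add: mpermute_def eval_mpoly_def monom_eval_def [symmetric] mconst_def mult_single)
  then show ?thesis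
    by (simp add: lookup_sum lookup_single when_def permute_exps_eq_iff [OF assms] in_keys_iff)
qed

text \<open>The order on exponents is the lexicographic one of the library, with variable 0 the most
  significant.\<close>

definition monic_at :: "('m::linorder \<Rightarrow>\<^sub>0 'a::comm_ring_1) \<Rightarrow> 'm \<Rightarrow> bool" where
  "monic_at F m \<longleftrightarrow> Poly_Mapping.lookup F m = 1 \<and> (\<forall>n\<in>Poly_Mapping.keys F. n \<le> m)"

lemma monic_at_one: "monic_at (1 :: 'm::{linorder,comm_monoid_add} \<Rightarrow>\<^sub>0 'a::comm_ring_1) 0"
  by (simp add: monic_at_def)

text \<open>The order is compatible with addition, so exponents \<open>k \<le> m\<close> and
  \<open>l \<le> n\<close> add up to \<open>m + n\<close> only if \<open>k = m\<close> and
  \<open>l = n\<close>.\<close>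

lemma monic_at_mult:
  fixes F G :: "('x::linorder, 'a::comm_ring_1) mpoly"
  assumes "monic_at F m" "monic_at G n"
  shows "monic_at (F * G) (m + n)"
proof -
  have le: "k \<le> m" "l \<le> n" if "k \<in> Poly_Mapping.keys F" "l \<in> Poly_Mapping.keys G" for k l
    using assms that by (auto simp: monic_at_def)
  have "Poly_Mapping.lookup (F * G) (m + n) = (\<Sum>k\<in>Poly_Mapping.keys F. \<Sum>l\<in>Poly_Mapping.keys G.
      if l = n then (if k = m then Poly_Mapping.lookup F m * Poly_Mapping.lookup G n else 0) else 0)"
    unfolding mpoly_mult_eq_sum_single [of F G] lookup_sum lookup_single
  proof (intro sum.cong refl)
    fix k l assume kl: "k \<in> Poly_Mapping.keys F" "l \<in> Poly_Mapping.keys G"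
    have "k + l = m + n \<longleftrightarrow> k = m \<and> l = n"
      using le [OF kl] by (metis add_le_less_mono add_less_le_mono order_le_less order_less_irrefl)
    then show "(Poly_Mapping.lookup F k * Poly_Mapping.lookup G l when k + l = m + n) =
        (if l = n then (if k = m then Poly_Mapping.lookup F m * Poly_Mapping.lookup G n else 0) else 0)"
      by (auto simp: when_def)
  qed
  also have "\<dots> = Poly_Mapping.lookup F m * Poly_Mapping.lookup G n"
    using assms by (simp add: monic_at_def in_keys_iff)
  finally show ?thesis
    using assms keys_mult [of F G] by (fastforce simp: monic_at_def intro: add_mono)
qed

lemma monic_at_power:
  fixes F :: "('x::linorder, 'a::comm_ring_1) mpoly"
  shows "monic_at F m \<Longrightarrow> monic_at (F ^ k) (\<Sum>j<k. m)"
proof (induction k)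
  case (Suc k)
  then have "monic_at (F * F ^ k) (m + (\<Sum>j<k. m))"
    by (intro monic_at_mult)
  then show ?case
    by (simp only: power_Suc sum.lessThan_Suc add.commute)
qed (simp add: monic_at_one)

lemma monic_at_prod:
  fixes F :: "'i \<Rightarrow> ('x::linorder, 'a::comm_ring_1) mpoly"
  assumes "\<And>i. i \<in> I \<Longrightarrow> monic_at (F i) (m i)"
  shows "monic_at (prod F I) (sum m I)"
  using assms by (induction I rule: infinite_finite_induct) (simp_all add: monic_at_one monic_at_mult)

definition set_exps :: "'x set \<Rightarrow> 'x \<Rightarrow>\<^sub>0 nat" where
  "set_exps S = (\<Sum>i\<in>S. Poly_Mapping.single i 1)"

lemma lookup_set_exps: "Poly_Mapping.lookup (set_exps (S :: 'x::finite set)) i = (if i \<in> S then 1 else 0)"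
  by (simp add: set_exps_def lookup_sum lookup_single when_def)

lemma set_exps_eq_iff: "set_exps S = set_exps (T :: 'x::finite set) \<longleftrightarrow> S = T"
  by (metis lookup_set_exps poly_mapping_eq_iff set_eqI zero_neq_one)

lemma elem_sym_mvar:
  "elem_sym n mvar = (\<Sum>S | card S = n. Poly_Mapping.single (set_exps S) (1 :: 'a::comm_ring_1))"
  by (simp add: elem_sym_def mvar_def prod_single_one set_exps_def)

text \<open>\<open>T\<close> is an initial segment. For another set \<open>S\<close> of the same
  size, the exponents first differ at the least element of \<open>T - S\<close>, where those of
  \<open>S\<close> are smaller.\<close>

lemma monic_at_elem_sym:
  fixes T :: "'x::{finite, linorder} set"
  assumes T: "card T = n" "\<And>i j. j \<in> T \<Longrightarrow> i < j \<Longrightarrow> i \<in> T"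
  shows "monic_at (elem_sym n mvar :: ('x, 'a::comm_ring_1) mpoly) (set_exps T)"
  unfolding monic_at_def
proof (intro conjI ballI)
  show "Poly_Mapping.lookup (elem_sym n mvar :: ('x, 'a) mpoly) (set_exps T) = 1"
    using T(1) by (simp add: elem_sym_mvar lookup_sum lookup_single when_def set_exps_eq_iff)
  fix m assume "m \<in> Poly_Mapping.keys (elem_sym n mvar :: ('x, 'a) mpoly)"
  then obtain S where S: "card S = n" "m = set_exps S"
    unfolding elem_sym_mvar in_keys_iff lookup_sum lookup_single
    by (auto elim!: sum.not_neutral_contains_not_neutral simp: when_def split: if_splits)
  show "m \<le> set_exps T"
  proof (cases "S = T")
    case False
    then have "T - S \<noteq> {}"
      using S(1) T(1) by (metis Diff_eq_empty_iff card_subset_eq finite)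
    define k where "k = Min (T - S)"
    have k: "k \<in> T" "k \<notin> S"
      using Min_in [OF _ \<open>T - S \<noteq> {}\<close>] by (auto simp: k_def)
    have eq: "Poly_Mapping.lookup (set_exps S) j = Poly_Mapping.lookup (set_exps T) j" if "j < k" for j
    proof -
      have "j \<in> T" using T(2) k(1) that by blast
      moreover have "j \<in> S"
        using \<open>j \<in> T\<close> that by (metis DiffI Min_le finite k_def linorder_not_le)
      ultimately show ?thesis by (simp add: lookup_set_exps)
    qed
    have "Poly_Mapping.lookup (set_exps S) k < Poly_Mapping.lookup (set_exps T) k"
      using k by (simp add: lookup_set_exps)
    with eq have "set_exps S < set_exps T"
      unfolding less_poly_mapping.rep_eq less_fun_def by blast
    then show ?thesis by (simp add: S)
  qed (simp add: S)
qed

lemma hom_elem_sym: "unital_hom h \<Longrightarrow> h (elem_sym n x) = elem_sym n (h \<circ> x)"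
  by (simp add: elem_sym_def unital_hom.sum unital_hom.prod)

lemma elem_sym_permute:
  fixes \<tau> :: "'x::finite \<Rightarrow> 'x"
  assumes "bij \<tau>"
  shows "elem_sym n (x \<circ> \<tau>) = elem_sym n x"
  unfolding elem_sym_def
proof (rule sum.reindex_bij_witness [of _ "\<lambda>S. inv \<tau> ` S" "\<lambda>S. \<tau> ` S"])
  have inj: "inj \<tau>" "surj \<tau>" "inj (inv \<tau>)" using assms by (auto simp: bij_is_inj bij_is_surj bij_imp_bij_inv)
  show "inv \<tau> ` \<tau> ` S = S" "\<tau> ` inv \<tau> ` S = S" for S
    using inj by (simp_all add: image_inv_f_f image_f_inv_f)
  show "\<tau> ` S \<in> {S. card S = n}" "inv \<tau> ` S \<in> {S. card S = n}" if "S \<in> {S. card S = n}" for S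
    using inj that by (auto simp: card_image inj_on_subset)
  show "(\<Prod>i\<in>\<tau> ` S. x i) = (\<Prod>i\<in>S. (x \<circ> \<tau>) i)" for S
    using inj(1) by (simp add: prod.reindex inj_on_subset)
qed

section \<open>Leading exponents of products of elementary symmetric polynomials\<close>

definition elem_sym3 :: "(3 \<Rightarrow> 'a::comm_ring_1) \<Rightarrow> 3 \<Rightarrow> 'a" where
  "elem_sym3 x i = elem_sym (if i = 1 then 1 else if i = 2 then 2 else 3) x"

lemma (in subring_of) elem_sym3_closed: "(\<And>i. x i \<in> S) \<Longrightarrow> elem_sym3 x i \<in> S"
  unfolding elem_sym3_def elem_sym_def by (intro sum_closed prod_closed)

text \<open>Initial segments of sizes 1, 2 and 3; the index 0 stands for the third elementary
  symmetric function and so takes all variables.\<close>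

definition lead_set :: "3 \<Rightarrow> 3 set" where
  "lead_set i = (if i = 1 then {0} else if i = 2 then {0, 1} else {0, 1, 2})"

definition lead_exps :: "(3 \<Rightarrow>\<^sub>0 nat) \<Rightarrow> 3 \<Rightarrow>\<^sub>0 nat" where
  "lead_exps m = (\<Sum>i\<in>UNIV. \<Sum>j<Poly_Mapping.lookup m i. set_exps (lead_set i))"

lemma monic_at_elem_sym3:
  "monic_at (monom_eval (elem_sym3 mvar) m :: (3, 'a::comm_ring_1) mpoly) (lead_exps m)"
proof -
  have "monic_at (elem_sym3 mvar i :: (3, 'a) mpoly) (set_exps (lead_set i))" for i
    unfolding elem_sym3_def by (rule monic_at_elem_sym) (auto simp: lead_set_def less_3_iff split: if_splits)
  then show ?thesis
    unfolding lead_exps_def monom_eval_superset [OF finite subset_UNIV]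
    by (intro monic_at_prod monic_at_power)
qed

text \<open>The index 0 belongs to the product of all three variables, so its multiplicity enters
  every exponent.\<close>

lemma lookup_lead_exps:
  "Poly_Mapping.lookup (lead_exps m) 0 = Poly_Mapping.lookup m 0 + Poly_Mapping.lookup m 1 + Poly_Mapping.lookup m 2"
  "Poly_Mapping.lookup (lead_exps m) 1 = Poly_Mapping.lookup m 0 + Poly_Mapping.lookup m 2"
  "Poly_Mapping.lookup (lead_exps m) 2 = Poly_Mapping.lookup m 0"
  unfolding lead_exps_def lookup_sum lookup_set_exps UNIV_3_eq
  by (simp_all add: lead_set_def)

lemma exps3_eqI:
  assumes "Poly_Mapping.lookup m 0 = Poly_Mapping.lookup n 0" "Poly_Mapping.lookup m 1 = Poly_Mapping.lookup n 1"
    "Poly_Mapping.lookup m 2 = Poly_Mapping.lookup n (2 :: 3)"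
  shows "m = n"
proof (rule poly_mapping_eqI)
  fix i :: 3
  have "i \<in> {0, 1, 2}" using UNIV_3_eq by blast
  then show "Poly_Mapping.lookup m i = Poly_Mapping.lookup n i" using assms by auto
qed

lemma lead_exps_eq_iff: "lead_exps m = lead_exps n \<longleftrightarrow> m = n"
proof
  assume "lead_exps m = lead_exps n"
  then show "m = n"
    using lookup_lead_exps [of m] lookup_lead_exps [of n] by (intro exps3_eqI) simp_all
qed simp

text \<open>The multiplicities are the successive differences of the exponents; the assumptions make
  the subtractions of naturals exact.\<close>

lemma lead_exps_surj:
  assumes "Poly_Mapping.lookup m 2 \<le> Poly_Mapping.lookup m 1" "Poly_Mapping.lookup m 1 \<le> Poly_Mapping.lookup m 0"
  obtains n where "lead_exps n = m"
proof -
  define n :: "3 \<Rightarrow>\<^sub>0 nat" where "n = Poly_Mapping.single 0 (Poly_Mapping.lookup m 2) +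
     Poly_Mapping.single 1 (Poly_Mapping.lookup m 0 - Poly_Mapping.lookup m 1) +
     Poly_Mapping.single 2 (Poly_Mapping.lookup m 1 - Poly_Mapping.lookup m 2)"
  have "Poly_Mapping.lookup n 0 = Poly_Mapping.lookup m 2"
    "Poly_Mapping.lookup n 1 = Poly_Mapping.lookup m 0 - Poly_Mapping.lookup m 1"
    "Poly_Mapping.lookup n 2 = Poly_Mapping.lookup m 1 - Poly_Mapping.lookup m 2"
    by (simp_all add: n_def lookup_add lookup_single)
  then have "lead_exps n = m"
    using assms by (intro exps3_eqI) (simp_all add: lookup_lead_exps)
  then show ?thesis by (rule that)
qed

text \<open>Distinct monomials in the elementary symmetric polynomials have distinct leading
  exponents with coefficient 1, so the largest of these cannot cancel.\<close>

lemma eval_elem_sym3_inj: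
  "inj (eval_mpoly mconst (elem_sym3 mvar) :: (3, 'a::comm_ring_1) mpoly \<Rightarrow> (3, 'a) mpoly)"
proof -
  let ?\<Theta> = "eval_mpoly mconst (elem_sym3 mvar) :: (3, 'a) mpoly \<Rightarrow> (3, 'a) mpoly"
  interpret unital_hom ?\<Theta> by (intro unital_hom_eval_mpoly unital_hom_mconst)
  have "?\<Theta> G \<noteq> 0" if "G \<noteq> 0" for G
  proof -
    have ne: "Poly_Mapping.keys G \<noteq> {}" using that by simp
    define k where "k = Max (lead_exps ` Poly_Mapping.keys G)"
    have "k \<in> lead_exps ` Poly_Mapping.keys G"
      unfolding k_def using ne by (intro Max_in) auto
    then obtain m where m: "m \<in> Poly_Mapping.keys G" "k = lead_exps m" by blast
    have "Poly_Mapping.lookup (?\<Theta> G) k = (\<Sum>n\<in>Poly_Mapping.keys G. if n = m then Poly_Mapping.lookup G m else 0)"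
      unfolding eval_mpoly_def monom_eval_def [symmetric] lookup_sum
    proof (intro sum.cong refl)
      fix n assume n: "n \<in> Poly_Mapping.keys G"
      note monic = monic_at_elem_sym3 [of n, where 'a = 'a]
      have le: "lead_exps n \<le> k" unfolding k_def using n by (intro Max_ge) auto
      have "Poly_Mapping.lookup (mconst c * F) k = c * Poly_Mapping.lookup F k" for c and F :: "(3, 'a) mpoly"
        by (rule lookup_mconst_mult)
      moreover have "Poly_Mapping.lookup (monom_eval (elem_sym3 mvar) n :: (3, 'a) mpoly) k = (if n = m then 1 else 0)"
      proof (cases "n = m")
        case True
        then show ?thesis using monic m(2) by (simp add: monic_at_def)
      next
        case False
        then have "lead_exps n < k" using le m(2) by (simp add: lead_exps_eq_iff order_less_le)
        then show ?thesis
          using monic False by (auto simp: monic_at_def in_keys_iff simp flip: not_less)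
      qed
      ultimately show "Poly_Mapping.lookup (mconst (Poly_Mapping.lookup G n) * monom_eval (elem_sym3 mvar) n) k =
          (if n = m then Poly_Mapping.lookup G m else 0)"
        by simp
    qed
    also have "\<dots> \<noteq> 0" using m(1) by (simp add: in_keys_iff)
    finally show ?thesis by auto
  qed
  then show ?thesis
    by (intro injI) (metis diff right_minus_eq)
qed

section \<open>Symmetric polynomials in terms of the elementary ones\<close>

definition symmetric_mpolys :: "(3, 'a::comm_ring_1) mpoly set" where
  "symmetric_mpolys = {F. \<forall>\<tau>. bij \<tau> \<longrightarrow> mpermute \<tau> F = F}"

lemma eval_elem_sym3_symmetric:
  fixes G :: "(3, 'a::comm_ring_1) mpoly"
  shows "eval_mpoly mconst (elem_sym3 mvar) G \<in> symmetric_mpolys"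
proof -
  have "mpermute \<tau> (eval_mpoly mconst (elem_sym3 mvar) G) = eval_mpoly mconst (elem_sym3 mvar) G"
    if "bij \<tau>" for \<tau>
  proof -
    have "mpermute \<tau> \<circ> mvar = (mvar \<circ> \<tau> :: 3 \<Rightarrow> (3, 'a) mpoly)" by auto
    then have "mpermute \<tau> (elem_sym3 mvar i :: (3, 'a) mpoly) = elem_sym3 mvar i" for i
      unfolding elem_sym3_def by (simp only: hom_elem_sym [OF unital_hom_mpermute] elem_sym_permute [OF that])
    then show ?thesis
      by (simp add: hom_eval_mpoly [OF unital_hom_mpermute] o_def)
  qed
  then show ?thesis by (simp add: symmetric_mpolys_def)
qed

text \<open>If a later exponent exceeded its predecessor, exchanging the two variables would produce
  a larger exponent vector in the support of \<open>F\<close>.\<close>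

lemma symmetric_leading_exps:
  assumes "F \<in> symmetric_mpolys" "m \<in> Poly_Mapping.keys F" "\<And>n. n \<in> Poly_Mapping.keys F \<Longrightarrow> n \<le> m"
  shows "Poly_Mapping.lookup m 2 \<le> Poly_Mapping.lookup m 1" "Poly_Mapping.lookup m 1 \<le> Poly_Mapping.lookup m 0"
proof -
  have swap: "permute_exps (Transposition.transpose i j) m \<le> m" for i j
  proof -
    have "bij (Transposition.transpose i j)" by simp
    then have "mpermute (Transposition.transpose i j) F = F" "inj (Transposition.transpose i j)"
      using assms(1) by (auto simp: symmetric_mpolys_def bij_is_inj)
    then have "permute_exps (Transposition.transpose i j) m \<in> Poly_Mapping.keys F"
      using lookup_mpermute [of "Transposition.transpose i j" F m] assms(2) by (simp add: in_keys_iff)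
    then show ?thesis by (rule assms(3))
  qed
  have lookup: "Poly_Mapping.lookup (permute_exps (Transposition.transpose i j) m) k = Poly_Mapping.lookup m (Transposition.transpose i j k)" for i j k
    using lookup_permute_exps [of "Transposition.transpose i j" m "Transposition.transpose i j k"] by (simp add: bij_is_inj)
  show "Poly_Mapping.lookup m 2 \<le> Poly_Mapping.lookup m 1"
  proof (rule ccontr)
    assume "\<not> Poly_Mapping.lookup m 2 \<le> Poly_Mapping.lookup m 1"
    then have "m < permute_exps (Transposition.transpose 1 2) m"
      by (auto simp: less_poly_mapping.rep_eq less_fun_def lookup less_3_iff intro!: exI [of _ 1])
    with swap [of 1 2] show False by simp
  qed
  show "Poly_Mapping.lookup m 1 \<le> Poly_Mapping.lookup m 0"
  proof (rule ccontr)
    assume "\<not> Poly_Mapping.lookup m 1 \<le> Poly_Mapping.lookup m 0"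
    then have "m < permute_exps (Transposition.transpose 0 1) m"
      by (auto simp: less_poly_mapping.rep_eq less_fun_def lookup less_3_iff intro!: exI [of _ 0])
    with swap [of 0 1] show False by simp
  qed
qed

text \<open>The order embeds into the lexicographic product of three copies of the naturals; it
  carries the induction in \<open>symmetric_mpolys_eq_eval\<close>.\<close>

lemma wf_exps3: "wf {(m, n :: 3 \<Rightarrow>\<^sub>0 nat). m < n}"
proof (rule wf_subset)
  let ?f = "\<lambda>m :: 3 \<Rightarrow>\<^sub>0 nat. (Poly_Mapping.lookup m 0, Poly_Mapping.lookup m 1, Poly_Mapping.lookup m 2)"
  show "wf (inv_image (less_than <*lex*> less_than <*lex*> less_than) ?f)"
    by (intro wf_inv_image wf_lex_prod wf_less_than)
  show "{(m, n). m < n} \<subseteq> inv_image (less_than <*lex*> less_than <*lex*> less_than) ?f"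
  proof clarify
    fix m n :: "3 \<Rightarrow>\<^sub>0 nat" assume "m < n"
    then obtain k where k: "Poly_Mapping.lookup m k < Poly_Mapping.lookup n k"
        "\<And>j. j < k \<Longrightarrow> Poly_Mapping.lookup m j = Poly_Mapping.lookup n j"
      by (auto simp: less_poly_mapping.rep_eq less_fun_def)
    have "k \<in> {0, 1, 2}" using UNIV_3_eq by blast
    then show "(m, n) \<in> inv_image (less_than <*lex*> less_than <*lex*> less_than) ?f"
      using k by (auto simp: less_3_iff)
  qed
qed

lemma symmetric_mpolys_diff:
  "F \<in> symmetric_mpolys \<Longrightarrow> G \<in> symmetric_mpolys \<Longrightarrow> F - G \<in> symmetric_mpolys"
  by (simp add: symmetric_mpolys_def unital_hom.diff [OF unital_hom_mpermute])

text \<open>The leading exponents of \<open>F\<close> are those of some product of elementary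
  symmetric polynomials. Subtracting the matching multiple lowers the leading term and, that product
  being monic, requires no division in \<open>A\<close>.\<close>

lemma symmetric_mpolys_eq_eval:
  fixes A :: "'a::comm_ring_1 set"
  assumes "subring_of A" "F \<in> symmetric_mpolys" "F \<in> mpolys_over A"
  shows "\<exists>G\<in>mpolys_over A. F = eval_mpoly mconst (elem_sym3 mvar) G"
proof -
  let ?\<Theta> = "eval_mpoly mconst (elem_sym3 mvar) :: (3, 'a) mpoly \<Rightarrow> (3, 'a) mpoly"
  interpret \<Theta>: unital_hom ?\<Theta> by (intro unital_hom_eval_mpoly unital_hom_mconst)
  interpret A: subring_of A by fact
  interpret S: subring_of "mpolys_over A :: (3, 'a) mpoly set" by (rule subring_of_mpolys_over) fact
  have elem: "elem_sym3 mvar i \<in> (mpolys_over A :: (3, 'a) mpoly set)" for i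
    by (intro S.elem_sym3_closed mvar_in_mpolys_over) auto
  have "F \<noteq> 0 \<longrightarrow> Max (Poly_Mapping.keys F) = m \<longrightarrow> F \<in> symmetric_mpolys \<longrightarrow> F \<in> mpolys_over A \<longrightarrow> (\<exists>G\<in>mpolys_over A. F = ?\<Theta> G)" for F m
  proof (induction m arbitrary: F rule: wf_induct_rule [OF wf_exps3])
    case (1 m)
    show ?case
    proof (intro impI)
      assume F: "F \<noteq> 0" "Max (Poly_Mapping.keys F) = m" "F \<in> symmetric_mpolys" "F \<in> mpolys_over A"
      have m: "m \<in> Poly_Mapping.keys F" "\<And>n. n \<in> Poly_Mapping.keys F \<Longrightarrow> n \<le> m"
        using F(1,2) Max_in [of "Poly_Mapping.keys F"] Max_ge [of "Poly_Mapping.keys F"] by auto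
      obtain n where n: "lead_exps n = m"
        using symmetric_leading_exps [OF F(3) m] by (rule lead_exps_surj)
      define c where "c = Poly_Mapping.lookup F m"
      \<comment> \<open>The monomial whose image under \<open>?\<Theta>\<close> has the same leading
        term as \<open>F\<close>.\<close>
      define H where "H = (Poly_Mapping.single n c :: (3, 'a) mpoly)"
      have H: "H \<in> mpolys_over A"
        using F(4) by (simp add: H_def c_def mpolys_over_def lookup_single when_def)
      define E where "E = (monom_eval (elem_sym3 mvar) n :: (3, 'a) mpoly)"
      have E: "Poly_Mapping.lookup E m = 1" "\<And>k. k \<in> Poly_Mapping.keys E \<Longrightarrow> k \<le> m"
        using monic_at_elem_sym3 [of n, where 'a = 'a] by (auto simp: monic_at_def n E_def)
      have lookup: "Poly_Mapping.lookup (?\<Theta> H) k = c * Poly_Mapping.lookup E k" for k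
        by (simp add: H_def E_def eval_mpoly_single unital_hom.zero [OF unital_hom_mconst] lookup_mconst_mult)
      define F' where "F' = F - ?\<Theta> H"
      have F': "F' \<in> symmetric_mpolys" "F' \<in> mpolys_over A"
        unfolding F'_def
        by (intro symmetric_mpolys_diff F eval_elem_sym3_symmetric)
          (intro S.diff_closed F S.eval_mpoly_closed elem mconst_in_mpolys_over, use H in \<open>auto simp: mpolys_over_def\<close>)
      have keys: "k < m" if "k \<in> Poly_Mapping.keys F'" for k
      proof -
        have "k \<noteq> m" using that by (auto simp: in_keys_iff F'_def lookup_minus lookup E c_def)
        moreover have "k \<in> Poly_Mapping.keys F \<or> k \<in> Poly_Mapping.keys E"
          using that by (auto simp: in_keys_iff F'_def lookup_minus lookup)
        ultimately show ?thesis using m(2) E(2) by (auto simp: order_less_le)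
      qed
      have "\<exists>G\<in>mpolys_over A. F' = ?\<Theta> G"
      proof (cases "F' = 0")
        case True
        then show ?thesis by (intro bexI [of _ 0]) auto
      next
        case False
        then have "Max (Poly_Mapping.keys F') < m"
          using keys by (simp add: Max_in)
        then show ?thesis
          using 1 [of "Max (Poly_Mapping.keys F')" F'] False F' by blast
      qed
      then obtain G where "G \<in> mpolys_over A" "F' = ?\<Theta> G" by blast
      then show "\<exists>G\<in>mpolys_over A. F = ?\<Theta> G"
        using H by (intro bexI [of _ "G + H"]) (auto simp: F'_def algebra_simps)
    qed
  qed
  then show ?thesis
    using assms(2,3) by (cases "F = 0") (auto intro: bexI [of _ 0])
qed

section \<open>The image of the Brown--Peterson ring\<close>

lemma unital_hom_form_const: "unital_hom form_const"
  by (rule unital_homI) (simp_all add: form_const_def one_pCons one_fun_def plus_fun_def times_fun_def mult.commute)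

text \<open>Both maps agree on integers, and the image of a nonzero integer is invertible. This
  determines a genus, given only as a ring homomorphism, on rational constants.\<close>

lemma unital_hom_rat_unique:
  fixes h k :: "rat \<Rightarrow> 'b::comm_ring_1"
  assumes "unital_hom h" "unital_hom k"
  shows "h = k"
proof
  fix q
  interpret h: unital_hom h by fact
  interpret k: unital_hom k by fact
  obtain m n where mn: "quotient_of q = (m, n)" by (cases "quotient_of q")
  have n: "n \<noteq> 0" and q: "q = of_int m / of_int n"
    using quotient_of_denom_pos [OF mn] quotient_of_div [OF mn] by auto
  have "h q * of_int n = h (q * of_int n)" by (simp only: h.mult h.of_int)
  also have "q * of_int n = of_int m" using n q by simp
  finally have h: "h q * of_int n = of_int m" by (simp only: h.of_int)
  have "of_int n * k (1 / of_int n) = k (of_int n * (1 / of_int n))" by (simp only: k.mult k.of_int)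
  then have inv: "of_int n * k (1 / of_int n) = 1" using n by simp
  have "h q = h q * (of_int n * k (1 / of_int n))" by (simp only: inv mult_1_right)
  also have "\<dots> = of_int m * k (1 / of_int n)" by (simp only: h flip: mult.assoc)
  also have "\<dots> = k (of_int m * (1 / of_int n))" by (simp only: k.mult k.of_int)
  also have "of_int m * (1 / of_int n) = q" using q by simp
  finally show "h q = k q" .
qed

text \<open>Permutations fix rational constants and \<open>P\<close>, hence every coefficient of the
  series built from them.\<close>

lemma mpermute_picard_hom:
  assumes "bij \<tau>"
  shows "mpermute \<tau> (picard_hom x) = picard_hom x"
proof -
  let ?P = "mpermute \<tau> :: (3, complex) mpoly \<Rightarrow> _"
  have 1: "?P \<circ> mvar = mvar \<circ> \<tau>" "?P \<circ> rat_const = rat_const"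
    by auto
  have "fps_map ?P picard_log_deriv = picard_log_deriv"
    unfolding picard_log_deriv_def fps_map_binom_power [OF unital_hom_mpermute]
      fps_map_picard_poly [OF unital_hom_mpermute] 1 picard_poly_permute [OF assms] ..
  then have "?P (picard_log_deriv $ n) = picard_log_deriv $ n" for n
    by (metis fps_map_nth)
  then have 2: "?P \<circ> (\<lambda>n. picard_log_deriv $ Suc n) = (\<lambda>n. picard_log_deriv $ Suc n)"
    by auto
  show ?thesis
    unfolding picard_hom_def hom_eval_mpoly [OF unital_hom_mpermute] 1 2 ..
qed

lemma of_rat_localized_ints:
  assumes "q \<in> localized_ints p"
  shows "of_rat q \<in> localized_ints p"
proof -
  obtain a b where "\<not> int p dvd b" "q = of_int a / of_int b"
    using assms by (auto simp: localized_ints_def)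
  then show ?thesis
    unfolding localized_ints_def by (intro CollectI exI [of _ a] exI [of _ b]) (simp add: of_rat_divide)
qed

lemma picard_hom_BP:
  assumes "prime p" "[p = 1] (mod 3)" "x \<in> BP p"
  shows "picard_hom x \<in> symmetric_mpolys \<inter> mpolys_over (localized_ints p)"
proof
  show "picard_hom x \<in> symmetric_mpolys"
    by (simp add: symmetric_mpolys_def mpermute_picard_hom)
  interpret Z: subring_of "localized_ints p :: complex set"
    using assms(1) by (rule subring_of_localized_ints)
  interpret S: subring_of "mpolys_over (localized_ints p) :: (3, complex) mpoly set"
    by (rule subring_of_mpolys_over) unfold_locales
  obtain F where F: "F \<in> mpolys_over (localized_ints p)" "x = eval_mpoly mconst (\<lambda>k. hazewinkel p (Suc k)) F"
    using assms(3) by (auto simp: BP_def)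
  show "picard_hom x \<in> mpolys_over (localized_ints p)"
    unfolding F(2) hom_eval_mpoly [OF picard_hom.unital_hom_axioms]
  proof (rule S.eval_mpoly_closed)
    show "(picard_hom \<circ> mconst) (Poly_Mapping.lookup F m) \<in> mpolys_over (localized_ints p)" for m
      using F(1) by (simp add: picard_hom_mconst mconst_in_mpolys_over of_rat_localized_ints mpolys_over_def [of "_ :: rat set"])
    show "(picard_hom \<circ> (\<lambda>k. hazewinkel p (Suc k))) i \<in> mpolys_over (localized_ints p)" for i
      using picard_hom_hazewinkel_integral [OF assms(1,2)] by simp
  qed
qed

text \<open>The coefficient of index \<open>n\<close> of the derivative of the logarithm is the
  value on \<open>CP n\<close>, and these classes together with the constants generate
  \<open>MUQ\<close>.\<close>

lemma picard_genus_eq: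
  assumes "picard_genus \<xi> \<phi>"
  shows "\<phi> = eval_mpoly form_const \<xi> \<circ> picard_hom"
proof
  fix x
  let ?E = "eval_mpoly form_const \<xi>"
  interpret E: unital_hom ?E by (intro unital_hom_eval_mpoly unital_hom_form_const)
  interpret \<phi>: unital_hom \<phi>
    using assms by unfold_locales (simp add: picard_genus_def rational_genus_def)
  have const: "?E \<circ> rat_const = form_const \<circ> of_rat"
    by (auto simp: unital_hom.zero [OF unital_hom_form_const])
  have var: "?E \<circ> mvar = \<xi>"
    by (auto simp: unital_hom_form_const)
  have map: "fps_map ?E picard_log_deriv = fps_deriv (genus_log \<phi>)"
  proof -
    have "fps_deriv (genus_log \<phi>) = binom_power (form_const \<circ> of_rat) (-1/3) (picard_poly \<xi>)"
      using assms unfolding picard_genus_def fps_rat_power_eq picard_poly_eq by blast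
    then show ?thesis
      unfolding picard_log_deriv_def fps_map_binom_power [OF E.unital_hom_axioms]
        fps_map_picard_poly [OF E.unital_hom_axioms] const var by (rule sym)
  qed
  have CP: "\<phi> (CP n) = ?E (picard_log_deriv $ n)" for n
  proof -
    interpret C: unital_hom form_const by (rule unital_hom_form_const)
    \<comment> \<open>Differentiation cancels the denominator that \<open>genus_log\<close> puts in
      front of \<open>\<phi> (CP n)\<close>.\<close>
    have "(of_nat (Suc n) :: graded_form) * form_const (1 / of_nat (Suc n)) = form_const (of_nat (Suc n) * (1 / of_nat (Suc n)))"
      by (simp only: C.mult C.of_nat)
    then have inv: "(of_nat (Suc n) :: graded_form) * form_const (1 / of_nat (Suc n)) = 1"
      by (simp del: of_nat_Suc)
    have "?E (picard_log_deriv $ n) = fps_deriv (genus_log \<phi>) $ n"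
      by (simp flip: map)
    also have "\<dots> = of_nat (Suc n) * form_const (1 / of_nat (Suc n)) * \<phi> (CP n)"
      by (simp add: genus_log_def mult.assoc del: of_nat_Suc)
    also have "\<dots> = \<phi> (CP n)"
      by (simp only: inv mult_1_left)
    finally show ?thesis ..
  qed
  have "\<phi> \<circ> mconst = form_const \<circ> of_rat"
    by (intro unital_hom_rat_unique unital_hom_comp unital_hom_form_const unital_hom_of_rat
      unital_hom_mconst \<phi>.unital_hom_axioms)
  moreover have "\<phi> \<circ> mvar = ?E \<circ> (\<lambda>n. picard_log_deriv $ Suc n)"
    using CP [of "Suc _"] by (auto simp: CP_def)
  moreover have "\<phi> x = eval_mpoly (\<phi> \<circ> mconst) (\<phi> \<circ> mvar) x"
    using hom_eval_mpoly [OF \<phi>.unital_hom_axioms, of mconst mvar x] by (simp add: eval_mpoly_mvar_id)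
  ultimately show "\<phi> x = (?E \<circ> picard_hom) x"
    by (simp add: picard_hom_def hom_eval_mpoly [OF E.unital_hom_axioms] const)
qed

text \<open>Evaluation at free generators is injective, so permuting a form means permuting the
  variables of its unique polynomial.\<close>

lemma S3_invariants_local_forms:
  assumes "free_form_generators \<xi>"
  shows "S3_invariants \<xi> (local_forms p \<xi>) =
    eval_mpoly form_const \<xi> ` (symmetric_mpolys \<inter> mpolys_over (localized_ints p))"
proof -
  let ?E = "eval_mpoly form_const \<xi>"
  have inj: "inj ?E"
    using assms by (simp add: free_form_generators_def bij_betw_def)
  have E: "unital_hom ?E" by (intro unital_hom_eval_mpoly unital_hom_form_const)
  have "permute_form \<xi> \<tau> (?E F) = ?E (mpermute \<tau> F)" for \<tau> F
  proof -
    have "?E \<circ> mconst = form_const" "?E \<circ> (mvar \<circ> \<tau>) = \<xi> \<circ> \<tau>"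
      by (auto simp: unital_hom_form_const unital_hom.zero [OF unital_hom_form_const])
    then show ?thesis
      by (simp add: permute_form_def inv_f_f [OF inj] mpermute_def hom_eval_mpoly [OF E])
  qed
  then show ?thesis
    by (auto simp: S3_invariants_def local_forms_def forms_over_def symmetric_mpolys_def inj_eq [OF inj])
qed

text \<open>Factoring through polynomials in independent variables reduces the claims about
  \<open>sigma \<xi>\<close> to symmetric polynomials.\<close>

lemma eval_mpoly_sigma:
  "eval_mpoly form_const (sigma \<xi>) G =
     eval_mpoly form_const \<xi> (eval_mpoly mconst (elem_sym3 mvar) G)"
proof -
  let ?E = "eval_mpoly form_const \<xi>"
  have E: "unital_hom ?E" by (intro unital_hom_eval_mpoly unital_hom_form_const)
  have "?E \<circ> mvar = \<xi>" "?E \<circ> mconst = form_const"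
    by (auto simp: unital_hom_form_const unital_hom.zero [OF unital_hom_form_const])
  moreover from this(1) have "?E \<circ> elem_sym3 mvar = sigma \<xi>"
    by (auto simp: elem_sym3_def sigma_def hom_elem_sym [OF E])
  ultimately show ?thesis
    by (simp add: hom_eval_mpoly [OF E])
qed

lemma eval_elem_sym3_bij_betw:
  fixes A :: "'a::comm_ring_1 set"
  assumes "subring_of A"
  shows "bij_betw (eval_mpoly mconst (elem_sym3 mvar)) (mpolys_over A) (symmetric_mpolys \<inter> mpolys_over A)"
  unfolding bij_betw_def
proof (intro conjI subset_antisym subsetI)
  interpret A: subring_of A by fact
  interpret S: subring_of "mpolys_over A :: (3, 'a) mpoly set" by (rule subring_of_mpolys_over) fact
  show "inj_on (eval_mpoly mconst (elem_sym3 mvar)) (mpolys_over A)"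
    using eval_elem_sym3_inj by (rule inj_on_subset) simp
  have elem: "elem_sym3 mvar i \<in> (mpolys_over A :: (3, 'a) mpoly set)" for i
    by (intro S.elem_sym3_closed mvar_in_mpolys_over) auto
  show "F \<in> symmetric_mpolys \<inter> mpolys_over A"
    if F: "F \<in> eval_mpoly mconst (elem_sym3 mvar) ` mpolys_over A" for F
  proof -
    obtain G where G: "G \<in> mpolys_over A" "F = eval_mpoly mconst (elem_sym3 mvar) G"
      using F by blast
    have "F \<in> mpolys_over A"
      unfolding G(2) using G(1)
      by (intro S.eval_mpoly_closed elem mconst_in_mpolys_over) (auto simp: mpolys_over_def)
    then show ?thesis
      by (simp add: G(2) eval_elem_sym3_symmetric)
  qed
  show "F \<in> eval_mpoly mconst (elem_sym3 mvar) ` mpolys_over A"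
    if "F \<in> symmetric_mpolys \<inter> mpolys_over A" for F
    using symmetric_mpolys_eq_eval [OF assms, of F] that by blast
qed

theorem theoremA0p1:
  fixes p :: nat and \<xi> :: "3 \<Rightarrow> graded_form" and \<phi> :: "MUQ \<Rightarrow> graded_form"
  assumes "prime p" and "[p = 1] (mod 3)"
    and "free_form_generators \<xi>"
    and "picard_genus \<xi> \<phi>"
  shows "\<phi> ` BP p \<subseteq> S3_invariants \<xi> (local_forms p \<xi>)
    \<and> ring_iso_on (mpolys_over (localized_ints p)) (S3_invariants \<xi> (local_forms p \<xi>))
        (eval_mpoly form_const (sigma \<xi>))"
proof
  note inv = S3_invariants_local_forms [OF assms(3)]
  show "\<phi> ` BP p \<subseteq> S3_invariants \<xi> (local_forms p \<xi>)"
    unfolding inv picard_genus_eq [OF assms(4)] image_comp [symmetric]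
    using picard_hom_BP [OF assms(1,2)] by (intro image_mono) auto
  have "inj (eval_mpoly form_const \<xi>)"
    using assms(3) by (simp add: free_form_generators_def bij_betw_def)
  then have "bij_betw (eval_mpoly form_const \<xi>) (symmetric_mpolys \<inter> mpolys_over (localized_ints p))
      (S3_invariants \<xi> (local_forms p \<xi>))"
    unfolding inv by (intro inj_on_imp_bij_betw) (rule inj_on_subset, auto)
  \<comment> \<open>The isomorphism is the bijection onto symmetric polynomials followed by
    evaluation at the free generators.\<close>
  with eval_elem_sym3_bij_betw [OF subring_of_localized_ints [OF assms(1)]]
  have "bij_betw (eval_mpoly form_const \<xi> \<circ> eval_mpoly mconst (elem_sym3 mvar))
      (mpolys_over (localized_ints p)) (S3_invariants \<xi> (local_forms p \<xi>))"
    by (rule bij_betw_trans)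
  moreover have "eval_mpoly form_const \<xi> \<circ> eval_mpoly mconst (elem_sym3 mvar) = eval_mpoly form_const (sigma \<xi>)"
    by (auto simp: eval_mpoly_sigma)
  moreover have "unital_hom (eval_mpoly form_const (sigma \<xi>))"
    by (intro unital_hom_eval_mpoly unital_hom_form_const)
  ultimately show "ring_iso_on (mpolys_over (localized_ints p)) (S3_invariants \<xi> (local_forms p \<xi>))
      (eval_mpoly form_const (sigma \<xi>))"
    by (simp add: ring_iso_on_def ring_hom_on_def unital_hom_def)
qed

end
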